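(* Let $f=\frac1n\sum_{i=1}^n f_i$ with $f_i=\frac1m\sum_{j=1}^m f_{ij}$, where each $f_{ij}:\mathbb{R}^d\to\mathbb{R}$ is convex and $L$-smooth, and let $x^\star$ be a minimizer of $f$, $f^\star=f(x^\star)$. Consider the VR-DIANA algorithm (either variant, described in the context) with an $\omega$-quantization operator $Q$, $0<\alpha\le\frac1{\omega+1}$ and $0<\gamma<\frac{1}{L(1+36(\omega+1)/n)}$. Let $$\psi^0=\|x^0-x^\star\|_2^2+b\gamma^2\sum_{i=1}^n\|h_i^0-\nabla f_i(x^\star)\|_2^2+c\gamma^2\sum_{i=1}^n\sum_{j=1}^m\|\nabla f_{ij}(w_{ij}^0)-\nabla f_{ij}(x^\star)\|_2^2,$$ with $b=\frac{4(\omega+1)}{\alpha n^2}$ and $c=\frac{16(\omega+1)}{n^2}$. Let $k\ge1$ and let $x^a$ be chosen uniformly at random from $\{x^0,x^1,\dots,x^{k-1}\}$ (independently of the algorithm). Then $$\mathbb{E}[f(x^a)-f^\star]\le\frac{\psi^0}{2k\left(\gamma-L\gamma^2\left[1+\frac{36(\omega+1)}{n}\right]\right)} .$$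
   Context: Differentiable $f$ is $L$-smooth ($L>0$) if $f(y)\le f(x)+\langle\nabla f(x),y-x\rangle+\frac L2\|x-y\|_2^2$ for all $x,y$. An $\omega$-quantization operator ($\omega\ge0$) is a random map $Q:\mathbb{R}^d\to\mathbb{R}^d$ such that for all $x$: $\mathbb{E}_Q[Q(x)]=x$ and $\mathbb{E}_Q[\|Q(x)\|_2^2]\le(\omega+1)\|x\|_2^2$. VR-DIANA algorithm. Input: $\alpha,\gamma>0$, (deterministic) vectors $x^0$, $h_i^0$, $w_{ij}^0\in\mathbb{R}^d$ ($1\le i\le n$, $1\le j\le m$). For $k=0,1,2,\dots$: (Variant 1 only) draw $u^k\in\{0,1\}$ with $P(u^k=1)=\frac1m$. For each worker $i=1,\dots,n$: draw $j_i^k$ uniformly at random from $\{1,\dots,m\}$; set $\mu_i^k=\frac1m\sum_{j=1}^m\nabla f_{ij}(w_{ij}^k)$, $g_i^k=\nabla f_{ij_i^k}(x^k)-\nabla f_{ij_i^k}(w_{ij_i^k}^k)+\mu_i^k$, $\hat\Delta_i^k=Q(g_i^k-h_i^k)$, $h_i^{k+1}=h_i^k+\alpha\hat\Delta_i^k$; and update, for all $j$: in Variant 1 (L-SVRG) $w_{ij}^{k+1}=x^k$ if $u^k=1$ and $w_{ij}^{k+1}=w_{ij}^k$ if $u^k=0$; in Variant 2 (SAGA) $w_{ij}^{k+1}=x^k$ if $j=j_i^k$ and $w_{ij}^{k+1}=w_{ij}^k$ otherwise. Then set $g^k=\frac1n\sum_{i=1}^n(\hat\Delta_i^k+h_i^k)$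 and $x^{k+1}=x^k-\gamma g^k$. All random draws ($u^k$, the $j_i^k$, and the internal randomness of each application of $Q$) are mutually independent and independent of the past. *)

theory Defs
  imports "HOL-Probability.Probability"
begin

definition grad :: "('a::real_inner \<Rightarrow> real) \<Rightarrow> 'a \<Rightarrow> 'a" where
  "grad f x = (THE D. GDERIV f x :> D)"

definition L_smooth :: "real \<Rightarrow> ('a::euclidean_space \<Rightarrow> real) \<Rightarrow> bool" where
  "L_smooth L f \<longleftrightarrow> 0 < L \<and> (\<forall>x. f differentiable (at x)) \<and>
     (\<forall>x y. f y \<le> f x + grad f x \<bullet> (y - x) + L / 2 * (norm (x - y))\<^sup>2)"

definition local_obj :: "nat \<Rightarrow> (nat \<Rightarrow> nat \<Rightarrow> 'a \<Rightarrow> real) \<Rightarrow> nat \<Rightarrow> 'a \<Rightarrow> real" where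
  "local_obj m f i x = (1 / real m) * (\<Sum>j=1..m. f i j x)"

definition global_obj :: "nat \<Rightarrow> nat \<Rightarrow> (nat \<Rightarrow> nat \<Rightarrow> 'a \<Rightarrow> real) \<Rightarrow> 'a \<Rightarrow> real" where
  "global_obj n m f x = (1 / real n) * (\<Sum>i=1..n. local_obj m f i x)"

text \<open>
  A random map is a family \<open>Q s\<close> of maps indexed by a seed \<open>s\<close> drawn from a probability
  space \<open>S\<close>. Joint measurability makes \<open>Q\<close> applied to a random argument a random variable.
  The integrability conditions say that both expectations exist and are finite; a Bochner
  integral of a non-integrable function would be 0.
\<close>

definition quantization_operator ::
    "real \<Rightarrow> 's measure \<Rightarrow> ('s \<Rightarrow> 'a::euclidean_space \<Rightarrow> 'a) \<Rightarrow> bool" where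
  "quantization_operator \<omega> S Q \<longleftrightarrow> 0 \<le> \<omega> \<and> prob_space S \<and>
     (\<lambda>(s, x). Q s x) \<in> borel_measurable (S \<Otimes>\<^sub>M borel) \<and>
     (\<forall>x. integrable S (\<lambda>s. Q s x) \<and> (\<integral>s. Q s x \<partial>S) = x \<and>
          integrable S (\<lambda>s. (norm (Q s x))\<^sup>2) \<and>
          (\<integral>s. (norm (Q s x))\<^sup>2 \<partial>S) \<le> (\<omega> + 1) * (norm x)\<^sup>2)"

datatype variant = LSVRG | SAGA

record 'a vrd_state =
  iter :: 'a
  shift :: "nat \<Rightarrow> 'a"
  ref :: "nat \<Rightarrow> nat \<Rightarrow> 'a"

text \<open>
  One iteration with realized draws: the coin \<open>u\<close> (ignored by SAGA), the sampled indices
  \<open>j i\<close>, and the maps \<open>q i\<close> that the quantizer realizes at worker \<open>i\<close>.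
\<close>

definition vr_diana_step ::
    "variant \<Rightarrow> nat \<Rightarrow> nat \<Rightarrow> (nat \<Rightarrow> nat \<Rightarrow> 'a::euclidean_space \<Rightarrow> real) \<Rightarrow> real \<Rightarrow> real \<Rightarrow>
     bool \<Rightarrow> (nat \<Rightarrow> nat) \<Rightarrow> (nat \<Rightarrow> 'a \<Rightarrow> 'a) \<Rightarrow> 'a vrd_state \<Rightarrow> 'a vrd_state" where
  "vr_diana_step v n m f \<alpha> \<gamma> u j q st =
    (let x = iter st; h = shift st; w = ref st;
         \<mu> = (\<lambda>i. (1 / real m) *\<^sub>R (\<Sum>l=1..m. grad (f i l) (w i l)));
         g = (\<lambda>i. grad (f i (j i)) x - grad (f i (j i)) (w i (j i)) + \<mu> i);
         \<Delta> = (\<lambda>i. q i (g i - h i))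
     in \<lparr> iter = x - \<gamma> *\<^sub>R ((1 / real n) *\<^sub>R (\<Sum>i=1..n. (\<Delta> i + h i))),
          shift = (\<lambda>i. h i + \<alpha> *\<^sub>R \<Delta> i),
          ref = (\<lambda>i l. case v of
                    LSVRG \<Rightarrow> if u then x else w i l
                  | SAGA \<Rightarrow> if l = j i then x else w i l) \<rparr>)"

primrec vr_diana ::
    "variant \<Rightarrow> nat \<Rightarrow> nat \<Rightarrow> (nat \<Rightarrow> nat \<Rightarrow> 'a::euclidean_space \<Rightarrow> real) \<Rightarrow> real \<Rightarrow> real \<Rightarrow>
     ('s \<Rightarrow> 'a \<Rightarrow> 'a) \<Rightarrow> 'a \<Rightarrow> (nat \<Rightarrow> 'a) \<Rightarrow> (nat \<Rightarrow> nat \<Rightarrow> 'a) \<Rightarrow>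
     (nat \<Rightarrow> bool) \<Rightarrow> (nat \<Rightarrow> nat \<Rightarrow> nat) \<Rightarrow> (nat \<Rightarrow> nat \<Rightarrow> 's) \<Rightarrow> nat \<Rightarrow> 'a vrd_state" where
  "vr_diana v n m f \<alpha> \<gamma> Q x0 h0 w0 u j s 0 = \<lparr> iter = x0, shift = h0, ref = w0 \<rparr>"
| "vr_diana v n m f \<alpha> \<gamma> Q x0 h0 w0 u j s (Suc t) =
     vr_diana_step v n m f \<alpha> \<gamma> (u t) (j t) (\<lambda>i. Q (s t i))
       (vr_diana v n m f \<alpha> \<gamma> Q x0 h0 w0 u j s t)"

text \<open>
  The draws take values in different types, so their mutual independence cannot be written
  with \<open>indep_vars\<close>. It is stated through \<open>indep_sets\<close> of the preimage
  \<open>\<sigma>\<close>-algebras, which is what \<open>indep_vars\<close> amounts to (\<open>indep_vars_def2\<close>). \<open>Output\<close> stands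
  for the index \<open>a\<close> of the returned iterate; only L-SVRG tosses coins.
\<close>

datatype draw = Coin nat | Index nat nat | Seed nat nat | Output

definition draws :: "variant \<Rightarrow> nat \<Rightarrow> draw set" where
  "draws v n = {Coin t | t. v = LSVRG} \<union> {Index t i | t i. i \<in> {1..n}} \<union>
     {Seed t i | t i. i \<in> {1..n}} \<union> {Output}"

definition preimages :: "'o measure \<Rightarrow> 'b measure \<Rightarrow> ('o \<Rightarrow> 'b) \<Rightarrow> 'o set set" where
  "preimages M N X = {X -` A \<inter> space M | A. A \<in> sets N}"

definition vr_diana_randomness ::
    "variant \<Rightarrow> nat \<Rightarrow> nat \<Rightarrow> nat \<Rightarrow> 's measure \<Rightarrow> 'o measure \<Rightarrow> (nat \<Rightarrow> 'o \<Rightarrow> bool) \<Rightarrow>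
     (nat \<Rightarrow> nat \<Rightarrow> 'o \<Rightarrow> nat) \<Rightarrow> (nat \<Rightarrow> nat \<Rightarrow> 'o \<Rightarrow> 's) \<Rightarrow> ('o \<Rightarrow> nat) \<Rightarrow> bool" where
  "vr_diana_randomness v n m k S M u j s a \<longleftrightarrow>
     prob_space M \<and>
     (v = LSVRG \<longrightarrow> (\<forall>t. u t \<in> measurable M (count_space UNIV) \<and>
        measure M {p \<in> space M. u t p} = 1 / real m)) \<and>
     (\<forall>t. \<forall>i\<in>{1..n}. j t i \<in> measurable M (count_space {1..m}) \<and>
        distr M (count_space {1..m}) (j t i) = uniform_count_measure {1..m}) \<and>
     (\<forall>t. \<forall>i\<in>{1..n}. s t i \<in> measurable M S \<and> distr M S (s t i) = S) \<and>
     a \<in> measurable M (count_space {0..<k}) \<and>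
     distr M (count_space {0..<k}) a = uniform_count_measure {0..<k} \<and>
     prob_space.indep_sets M
       (\<lambda>d. case d of
           Coin t \<Rightarrow> preimages M (count_space UNIV) (u t)
         | Index t i \<Rightarrow> preimages M (count_space {1..m}) (j t i)
         | Seed t i \<Rightarrow> preimages M S (s t i)
         | Output \<Rightarrow> preimages M (count_space {0..<k}) a)
       (draws v n)"

definition initial_potential ::
    "nat \<Rightarrow> nat \<Rightarrow> (nat \<Rightarrow> nat \<Rightarrow> 'a::euclidean_space \<Rightarrow> real) \<Rightarrow> real \<Rightarrow> real \<Rightarrow> real \<Rightarrow>
     'a \<Rightarrow> 'a \<Rightarrow> (nat \<Rightarrow> 'a) \<Rightarrow> (nat \<Rightarrow> nat \<Rightarrow> 'a) \<Rightarrow> real" where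
  "initial_potential n m f \<gamma> b c xs x0 h0 w0 =
     (norm (x0 - xs))\<^sup>2
     + b * \<gamma>\<^sup>2 * (\<Sum>i=1..n. (norm (h0 i - grad (local_obj m f i) xs))\<^sup>2)
     + c * \<gamma>\<^sup>2 * (\<Sum>i=1..n. \<Sum>j=1..m. (norm (grad (f i j) (w0 i j) - grad (f i j) xs))\<^sup>2)"

end

theory Submission imports Defs begin

text \<open>
  The proof is a one-round descent of a Lyapunov function. Let \<open>F t\<close> be the expected gap
  \<open>f(x\<^sup>t) - f\<^sup>*\<close>. Three quantities are followed in expectation: the squared distance of the iterate
  to \<open>xs\<close>, the total squared error of the shifts against the local gradients at \<open>xs\<close>, and the
  total squared error of the component gradients at the reference points. Their weighted sum, the
  potential, starts at \<open>\<psi>\<^sup>0\<close>.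

  Everything random in a round is concentrated in one vector per worker, the noise: received
  gradient minus true local gradient. It has mean zero given the past, it is uncorrelated across
  workers, and its second moment is at most \<open>\<omega> + 1\<close> times the sampling variance plus \<open>\<omega>\<close> times
  the squared distance between local gradient and shift (\<open>noise_orthogonal\<close>,
  \<open>expectation_noise_le\<close>). Both terms are small once the shifts and reference points are good, and
  otherwise they are paid for by the other two parts of the potential:
  \<^item> the distance to \<open>xs\<close> decreases by \<open>2 * \<gamma> * F t\<close> up to the noise (\<open>distance_Suc_le\<close>);
  \<^item> the shift errors contract by the factor \<open>1 - \<alpha>\<close> up to the sampling variance (\<open>shift_error_Suc_le\<close>);
  \<^item> the reference errors contract by the factor \<open>1 - 1 / m\<close>, since each reference point is
    replaced by the current iterate with probability \<open>1 / m\<close> in either variant (\<open>ref_error_Suc_le\<close>).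

  What each recursion adds on account of the current iterate is at most a multiple of \<open>F t\<close>:
  cocoercivity of the gradients of smooth convex functions bounds the squared gradient errors
  by Bregman divergences at \<open>xs\<close>, whose linear parts cancel in the sum
  (\<open>sum_deviation_le\<close>). Adding the three recursions yields
  \<open>potential (t + 1) \<le> potential t - 2 * \<kappa> * F t\<close>, where \<open>2 * k * \<kappa>\<close> is the denominator
  of the claim (\<open>potential_Suc_le\<close>). Summing over \<open>t < k\<close>, and averaging over the independent index
  of the returned iterate, gives the bound.

  On the probabilistic side the past of a round is a \<open>\<sigma>\<close>-algebra generated by the earlier draws.
  A mean-zero property given the past is expressed as orthogonality, in the space of
  square-integrable random vectors, to everything measurable with respect to it.
\<close>

section \<open>Squared norms of sums\<close>

lemma norm_add_power2_le:
  fixes a b :: "'b::real_inner"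
  shows "(norm (a + b))\<^sup>2 \<le> 2 * (norm a)\<^sup>2 + 2 * (norm b)\<^sup>2"
proof -
  have "0 \<le> (a - b) \<bullet> (a - b)" by (rule inner_ge_zero)
  then show ?thesis unfolding power2_norm_eq_inner
    by (simp add: inner_add_left inner_add_right inner_diff_left inner_diff_right inner_commute)
qed

lemma norm_sum_power2_le:
  fixes v :: "'i \<Rightarrow> 'a::real_inner"
  shows "(norm (\<Sum>i\<in>I. v i))\<^sup>2 \<le> real (card I) * (\<Sum>i\<in>I. (norm (v i))\<^sup>2)"
proof -
  have "(norm (\<Sum>i\<in>I. v i))\<^sup>2 \<le> (\<Sum>i\<in>I. norm (v i))\<^sup>2"
    by (intro power_mono norm_sum) simp
  also have "\<dots> \<le> real (card I) * (\<Sum>i\<in>I. (norm (v i))\<^sup>2)"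
    using sum_squared_le_sum_of_squares[of "\<lambda>i. norm (v i)" I]
    by (simp add: mult.commute)
  finally show ?thesis .
qed

text \<open>
  The mean minimizes the sum of squared distances, so it does at least as well as \<open>0\<close>. Read
  probabilistically, a variance is at most the second moment.
\<close>

lemma sum_norm_minus_mean_le:
  fixes v :: "'i \<Rightarrow> 'a::real_inner"
  shows "(\<Sum>l\<in>I. (norm (v l - (1 / real (card I)) *\<^sub>R (\<Sum>l\<in>I. v l)))\<^sup>2) \<le> (\<Sum>l\<in>I. (norm (v l))\<^sup>2)"
proof (cases "card I = 0")
  case False
  define c where "c = (1 / real (card I)) *\<^sub>R (\<Sum>l\<in>I. v l)"
  have total: "(\<Sum>l\<in>I. v l) = real (card I) *\<^sub>R c" using False by (simp add: c_def)
  have "(\<Sum>l\<in>I. (norm (v l - c))\<^sup>2) = (\<Sum>l\<in>I. (norm (v l))\<^sup>2 - 2 * (v l \<bullet> c) + c \<bullet> c)"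
    by (intro sum.cong) (auto simp: power2_norm_eq_inner inner_diff_left inner_diff_right inner_commute)
  also have "\<dots> = (\<Sum>l\<in>I. (norm (v l))\<^sup>2) - 2 * ((\<Sum>l\<in>I. v l) \<bullet> c) + real (card I) * (c \<bullet> c)"
    by (simp add: sum.distrib sum_subtractf sum_distrib_left inner_sum_left)
  also have "\<dots> = (\<Sum>l\<in>I. (norm (v l))\<^sup>2) - real (card I) * (c \<bullet> c)"
    unfolding total by simp
  also have "\<dots> \<le> (\<Sum>l\<in>I. (norm (v l))\<^sup>2)" by simp
  finally show ?thesis by (simp add: c_def)
qed simp

text \<open>
  Moving a fraction \<open>\<alpha>\<close> of the way from \<open>a\<close> to \<open>b\<close> gains a term proportional to the squared
  distance of \<open>a\<close> and \<open>b\<close>. In the recursion for the shifts this gain pays for the quantization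
  variance.
\<close>

lemma norm_convex_combination:
  fixes a b :: "'a::real_inner"
  shows "(norm (a + \<alpha> *\<^sub>R (b - a)))\<^sup>2
    = (1 - \<alpha>) * (norm a)\<^sup>2 + \<alpha> * (norm b)\<^sup>2 - \<alpha> * (1 - \<alpha>) * (norm (b - a))\<^sup>2"
  unfolding power2_norm_eq_inner
  by (simp add: inner_add_left inner_add_right inner_diff_left inner_diff_right inner_commute)
    (simp add: algebra_simps)

section \<open>Gradients of smooth convex functions\<close>

lemma grad_eqI:
  assumes "GDERIV f x :> D"
  shows "grad f x = D"
proof -
  have "D' = D" if "GDERIV f x :> D'" for D'
  proof -
    have "(\<lambda>h. h \<bullet> D') = (\<lambda>h. h \<bullet> D)"
      using has_derivative_unique assms that unfolding gderiv_def by blast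
    then have "(D' - D) \<bullet> (D' - D) = 0"
      by (metis inner_diff_right right_minus_eq)
    then show ?thesis by simp
  qed
  with assms show ?thesis unfolding grad_def by blast
qed

lemma GDERIV_grad:
  fixes f :: "'a::euclidean_space \<Rightarrow> real"
  assumes "f differentiable (at x)"
  shows "GDERIV f x :> grad f x"
proof -
  from assms obtain f' where f': "(f has_derivative f') (at x)"
    unfolding differentiable_def by blast
  interpret f': bounded_linear f' by (rule has_derivative_bounded_linear[OF f'])
  define D where "D = (\<Sum>e\<in>Basis. f' e *\<^sub>R e)"
  have "f' h = h \<bullet> D" for h
  proof -
    have "f' h = f' (\<Sum>e\<in>Basis. (h \<bullet> e) *\<^sub>R e)" by (simp add: euclidean_representation)
    also have "\<dots> = h \<bullet> D"
      by (simp add: f'.sum f'.scaleR D_def inner_sum_right mult.commute)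
    finally show ?thesis .
  qed
  then have "f' = (\<lambda>h. h \<bullet> D)" by (rule ext)
  with f' have "GDERIV f x :> D" by (simp add: gderiv_def)
  with grad_eqI[OF this] show ?thesis by simp
qed

text \<open>
  On the segment from \<open>x\<close> to \<open>y\<close> this is the tangent inequality for a convex function of one
  real variable.
\<close>

lemma convex_on_imp_above_grad:
  fixes f :: "'a::euclidean_space \<Rightarrow> real"
  assumes "convex_on UNIV f" "f differentiable (at x)"
  shows "f x + grad f x \<bullet> (y - x) \<le> f y"
proof -
  define \<phi> where "\<phi> t = f (x + t *\<^sub>R (y - x))" for t
  have "convex_on UNIV \<phi>"
  proof (rule convex_onI)
    fix t a b :: real assume t: "0 < t" "t < 1"
    have "x + ((1 - t) *\<^sub>R a + t *\<^sub>R b) *\<^sub>R (y - x)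
        = (1 - t) *\<^sub>R (x + a *\<^sub>R (y - x)) + t *\<^sub>R (x + b *\<^sub>R (y - x))"
      by (simp add: algebra_simps)
    then show "\<phi> ((1 - t) *\<^sub>R a + t *\<^sub>R b) \<le> (1 - t) * \<phi> a + t * \<phi> b"
      using convex_onD[OF assms(1), of t] t unfolding \<phi>_def by simp
  qed simp
  moreover have "(\<phi> has_field_derivative grad f x \<bullet> (y - x)) (at 0)"
  proof -
    have f: "(f has_derivative (\<lambda>h. h \<bullet> grad f x)) (at (x + 0 *\<^sub>R (y - x)))"
      using GDERIV_grad[OF assms(2)] by (simp add: gderiv_def)
    have "((\<lambda>t. x + t *\<^sub>R (y - x)) has_derivative (\<lambda>t. t *\<^sub>R (y - x))) (at (0::real))"
      by (auto intro!: derivative_eq_intros)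
    from has_derivative_compose[OF this f] show ?thesis
      unfolding has_field_derivative_def \<phi>_def
      by (simp add: inner_commute mult_commute_abs)
  qed
  ultimately have "\<phi> 1 - \<phi> 0 \<ge> (grad f x \<bullet> (y - x)) * (1 - 0)"
    by (intro convex_on_imp_above_tangent[of UNIV]) auto
  then show ?thesis by (simp add: \<phi>_def)
qed

text \<open>
  One gradient step of length \<open>1 / L\<close> from \<open>x\<close>, taken for the function obtained from \<open>f\<close> by
  subtracting its tangent at \<open>y\<close>, lowers that function by at least the left-hand side divided by \<open>2 * L\<close>;
  its minimum is attained at \<open>y\<close>. Combining the upper bound at \<open>x\<close> with the lower bound at \<open>y\<close>
  expresses this without introducing the function.
\<close>

lemma grad_cocoercive:
  fixes f :: "'a::euclidean_space \<Rightarrow> real"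
  assumes "convex_on UNIV f" "L_smooth L f"
  shows "(norm (grad f x - grad f y))\<^sup>2 \<le> 2 * L * (f x - f y - grad f y \<bullet> (x - y))"
proof -
  have L: "L > 0" and diff: "f differentiable (at z)"
    and upper: "f z' \<le> f z + grad f z \<bullet> (z' - z) + L / 2 * (norm (z - z'))\<^sup>2" for z z'
    using assms(2) by (auto simp: L_smooth_def)
  define \<delta> where "\<delta> = grad f x - grad f y"
  let ?z = "x - (1 / L) *\<^sub>R \<delta>"
  have "f y + grad f y \<bullet> (?z - y) \<le> f ?z"
    by (rule convex_on_imp_above_grad[OF assms(1) diff])
  also have "\<dots> \<le> f x + grad f x \<bullet> (?z - x) + L / 2 * (norm (x - ?z))\<^sup>2"
    by (rule upper)
  finally have "f y + grad f y \<bullet> (?z - y)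
      \<le> f x + grad f x \<bullet> (?z - x) + L / 2 * (norm (x - ?z))\<^sup>2" .
  moreover have "L / 2 * (norm (x - ?z))\<^sup>2 = (norm \<delta>)\<^sup>2 / (2 * L)"
    using L by (simp add: power_divide) (simp add: power2_eq_square)
  moreover have "grad f x \<bullet> (?z - x) = - ((grad f x \<bullet> \<delta>) / L)" by simp
  moreover have "grad f y \<bullet> (?z - y) = grad f y \<bullet> (x - y) - (grad f y \<bullet> \<delta>) / L"
    by (simp add: inner_diff_right)
  moreover have "(grad f x \<bullet> \<delta>) / L - (grad f y \<bullet> \<delta>) / L = (norm \<delta>)\<^sup>2 / L"
    unfolding diff_divide_distrib[symmetric] inner_diff_left[symmetric] \<delta>_def[symmetric]
    by (simp add: power2_norm_eq_inner)
  moreover have "(norm \<delta>)\<^sup>2 / L = 2 * ((norm \<delta>)\<^sup>2 / (2 * L))" by simp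
  ultimately have "(norm \<delta>)\<^sup>2 / (2 * L) \<le> f x - f y - grad f y \<bullet> (x - y)" by linarith
  then show ?thesis using L unfolding \<delta>_def[symmetric] by (simp add: divide_le_eq mult.commute)
qed

text \<open>
  Add cocoercivity for \<open>(x, y)\<close> and \<open>(y, x)\<close>: the function values cancel, and the
  Cauchy-Schwarz inequality finishes. Lipschitz continuity is what makes gradients at
  square-integrable random points measurable and square-integrable.
\<close>

lemma grad_Lipschitz:
  fixes f :: "'a::euclidean_space \<Rightarrow> real"
  assumes "convex_on UNIV f" "L_smooth L f"
  shows "norm (grad f x - grad f y) \<le> L * norm (x - y)"
proof (cases "grad f x = grad f y")
  case True
  then show ?thesis using assms(2) by (simp add: L_smooth_def)
next
  case False
  let ?d = "grad f x - grad f y"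
  have L: "L > 0" using assms(2) by (simp add: L_smooth_def)
  have "(norm ?d)\<^sup>2 + (norm ?d)\<^sup>2 \<le> 2 * L * (?d \<bullet> (x - y))"
    using grad_cocoercive[OF assms, of x y] grad_cocoercive[OF assms, of y x]
    by (simp add: norm_minus_commute algebra_simps)
  then have "(norm ?d)\<^sup>2 \<le> L * (?d \<bullet> (x - y))" by simp
  also have "\<dots> \<le> L * (norm ?d * norm (x - y))"
    using L norm_cauchy_schwarz by (intro mult_left_mono) auto
  finally show ?thesis using False by (simp add: power2_eq_square mult.left_commute)
qed

section \<open>Finite sums of smooth convex functions\<close>

locale finite_sum_problem =
  fixes n m :: nat and f :: "nat \<Rightarrow> nat \<Rightarrow> 'a::euclidean_space \<Rightarrow> real"
    and L :: real and xs :: 'a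
  assumes n: "n \<ge> 1" and m: "m \<ge> 1" and L: "L > 0"
    and convex: "\<And>i j. i \<in> {1..n} \<Longrightarrow> j \<in> {1..m} \<Longrightarrow> convex_on UNIV (f i j)"
    and smooth: "\<And>i j. i \<in> {1..n} \<Longrightarrow> j \<in> {1..m} \<Longrightarrow> L_smooth L (f i j)"
    and minimizer: "\<And>y. global_obj n m f xs \<le> global_obj n m f y"
begin

definition gap :: "'a \<Rightarrow> real" where
  "gap x = global_obj n m f x - global_obj n m f xs"

definition local_grad :: "nat \<Rightarrow> 'a \<Rightarrow> 'a" where
  "local_grad i x = (1 / real m) *\<^sub>R (\<Sum>l=1..m. grad (f i l) x)"

definition global_grad :: "'a \<Rightarrow> 'a" where
  "global_grad x = (1 / real n) *\<^sub>R (\<Sum>i=1..n. local_grad i x)"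

definition deviation :: "nat \<Rightarrow> nat \<Rightarrow> 'a \<Rightarrow> real" where
  "deviation i l x = (norm (grad (f i l) x - grad (f i l) xs))\<^sup>2"

lemma differentiable:
  "i \<in> {1..n} \<Longrightarrow> l \<in> {1..m} \<Longrightarrow> f i l differentiable (at x)"
  using smooth by (auto simp: L_smooth_def)

lemma has_derivative_component:
  "i \<in> {1..n} \<Longrightarrow> l \<in> {1..m} \<Longrightarrow> (f i l has_derivative (\<lambda>h. h \<bullet> grad (f i l) x)) (at x)"
  using GDERIV_grad[OF differentiable] by (simp add: gderiv_def)

lemma has_derivative_local_obj:
  assumes "i \<in> {1..n}"
  shows "(local_obj m f i has_derivative (\<lambda>h. h \<bullet> local_grad i x)) (at x)"
proof -
  have "((\<lambda>x. (1 / real m) * (\<Sum>l=1..m. f i l x)) has_derivative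
      (\<lambda>h. (1 / real m) * (\<Sum>l=1..m. h \<bullet> grad (f i l) x))) (at x)"
    using assms by (intro has_derivative_mult_right has_derivative_sum has_derivative_component) auto
  then show ?thesis
    by (simp add: local_obj_def[abs_def] local_grad_def inner_sum_right)
qed

lemma grad_local_obj: "i \<in> {1..n} \<Longrightarrow> grad (local_obj m f i) x = local_grad i x"
  using has_derivative_local_obj by (intro grad_eqI) (simp add: gderiv_def)

lemma has_derivative_global_obj:
  "(global_obj n m f has_derivative (\<lambda>h. h \<bullet> global_grad x)) (at x)"
proof -
  have "((\<lambda>x. (1 / real n) * (\<Sum>i=1..n. local_obj m f i x)) has_derivative
      (\<lambda>h. (1 / real n) * (\<Sum>i=1..n. h \<bullet> local_grad i x))) (at x)"
    by (intro has_derivative_mult_right has_derivative_sum has_derivative_local_obj) auto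
  then show ?thesis
    by (simp add: global_obj_def[abs_def] global_grad_def inner_sum_right)
qed

lemma global_grad_minimizer: "global_grad xs = 0"
proof -
  have "(\<lambda>h. h \<bullet> global_grad xs) = (\<lambda>h. 0)"
    using has_derivative_local_min[OF has_derivative_global_obj] minimizer by simp
  then have "global_grad xs \<bullet> global_grad xs = 0" by metis
  then show ?thesis by simp
qed

lemma gap_nonneg: "0 \<le> gap x"
  using minimizer by (simp add: gap_def)

lemma continuous_on_gap: "continuous_on UNIV gap"
proof -
  have "continuous (at x) (global_obj n m f)" for x
    by (rule has_derivative_continuous[OF has_derivative_global_obj])
  then show ?thesis unfolding gap_def[abs_def]
    by (intro continuous_intros continuous_at_imp_continuous_on) auto
qed

lemma gap_eq: "gap x = (1 / (real n * real m)) * (\<Sum>i=1..n. \<Sum>l=1..m. f i l x - f i l xs)"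
  by (simp add: gap_def global_obj_def local_obj_def sum_subtractf right_diff_distrib
      sum_distrib_left sum_divide_distrib divide_divide_eq_left mult.commute)

lemma inner_global_grad:
  "global_grad x \<bullet> y = (1 / (real n * real m)) * (\<Sum>i=1..n. \<Sum>l=1..m. grad (f i l) x \<bullet> y)"
  by (simp add: global_grad_def local_grad_def inner_sum_left sum_distrib_left
      sum_divide_distrib divide_divide_eq_left mult.commute)

text \<open>
  This bound, together with non-negativity, makes the gap at a square-integrable random point
  integrable.
\<close>

lemma gap_le_quadratic: "gap x \<le> L / 2 * (norm (x - xs))\<^sup>2"
proof -
  have "(\<Sum>i=1..n. \<Sum>l=1..m. f i l x - f i l xs)
      \<le> (\<Sum>i=1..n. \<Sum>l=1..m. grad (f i l) xs \<bullet> (x - xs) + L / 2 * (norm (xs - x))\<^sup>2)"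
  proof (intro sum_mono)
    fix i l assume "i \<in> {1..n}" "l \<in> {1..m}"
    with smooth have "f i l x \<le> f i l xs + grad (f i l) xs \<bullet> (x - xs) + L / 2 * (norm (xs - x))\<^sup>2"
      by (simp add: L_smooth_def)
    then show "f i l x - f i l xs \<le> grad (f i l) xs \<bullet> (x - xs) + L / 2 * (norm (xs - x))\<^sup>2"
      by simp
  qed
  then have "gap x \<le> (1 / (real n * real m)) *
      (\<Sum>i=1..n. \<Sum>l=1..m. grad (f i l) xs \<bullet> (x - xs) + L / 2 * (norm (xs - x))\<^sup>2)"
    unfolding gap_eq by (intro mult_left_mono) auto
  also have "\<dots> = global_grad xs \<bullet> (x - xs) + L / 2 * (norm (xs - x))\<^sup>2"
    using n m by (simp add: inner_global_grad sum.distrib add_divide_distrib)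
  finally show ?thesis by (simp add: global_grad_minimizer norm_minus_commute)
qed

lemma gap_le_inner_grad: "gap x \<le> global_grad x \<bullet> (x - xs)"
proof -
  have "f i l x - f i l xs \<le> grad (f i l) x \<bullet> (x - xs)" if "i \<in> {1..n}" "l \<in> {1..m}" for i l
    using convex_on_imp_above_grad[OF convex differentiable, OF that that, of x xs]
    by (simp add: inner_diff_right)
  then show ?thesis unfolding gap_eq inner_global_grad
    by (intro mult_left_mono sum_mono) auto
qed

text \<open>
  This is where convexity controls the variance: by cocoercivity each deviation is bounded by a
  Bregman divergence of \<open>f i l\<close> at \<open>xs\<close>. In the sum the linear terms cancel because the
  gradient of the global objective vanishes at its minimizer, and only the gap remains.
\<close>

lemma sum_deviation_le:
  "(\<Sum>i=1..n. \<Sum>l=1..m. deviation i l x) \<le> 2 * L * real n * real m * gap x"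
proof -
  have "(\<Sum>i=1..n. \<Sum>l=1..m. deviation i l x)
      \<le> (\<Sum>i=1..n. \<Sum>l=1..m. 2 * L * (f i l x - f i l xs - grad (f i l) xs \<bullet> (x - xs)))"
    unfolding deviation_def by (intro sum_mono grad_cocoercive convex smooth)
  also have "\<dots> = 2 * L * ((\<Sum>i=1..n. \<Sum>l=1..m. f i l x - f i l xs)
      - (\<Sum>i=1..n. \<Sum>l=1..m. grad (f i l) xs \<bullet> (x - xs)))"
    by (simp add: sum_subtractf sum_distrib_left right_diff_distrib)
  also have "(\<Sum>i=1..n. \<Sum>l=1..m. f i l x - f i l xs) = real n * real m * gap x"
    using n m by (simp add: gap_eq)
  also have "(\<Sum>i=1..n. \<Sum>l=1..m. grad (f i l) xs \<bullet> (x - xs)) = 0"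
    using inner_global_grad[of xs "x - xs"] n m by (simp add: global_grad_minimizer)
  finally show ?thesis by (simp add: mult_ac)
qed

lemma norm_local_grad_diff:
  "(norm (local_grad i x - local_grad i xs))\<^sup>2 \<le> (1 / real m) * (\<Sum>l=1..m. deviation i l x)"
proof -
  have "local_grad i x - local_grad i xs
      = (1 / real m) *\<^sub>R (\<Sum>l=1..m. grad (f i l) x - grad (f i l) xs)"
    unfolding local_grad_def sum_subtractf by (rule scaleR_right_diff_distrib[symmetric])
  then have "(norm (local_grad i x - local_grad i xs))\<^sup>2
      = (1 / real m)\<^sup>2 * (norm (\<Sum>l=1..m. grad (f i l) x - grad (f i l) xs))\<^sup>2"
    by (simp add: power_mult_distrib power_divide)
  also have "\<dots> \<le> (1 / real m)\<^sup>2 * (real (card {1..m}) * (\<Sum>l=1..m. deviation i l x))"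
    unfolding deviation_def by (intro mult_left_mono norm_sum_power2_le) auto
  also have "\<dots> = (1 / real m) * (\<Sum>l=1..m. deviation i l x)"
    using m by (simp add: power2_eq_square)
  finally show ?thesis .
qed

text \<open>
  The gradient at \<open>xs\<close> vanishes, so Jensen's inequality reduces the bound to the deviations of
  the components.
\<close>

lemma norm_global_grad: "(norm (global_grad x))\<^sup>2 \<le> 2 * L * gap x"
proof -
  have "global_grad x = (1 / real n) *\<^sub>R (\<Sum>i=1..n. local_grad i x - local_grad i xs)"
    using global_grad_minimizer n by (simp add: global_grad_def sum_subtractf)
  then have "(norm (global_grad x))\<^sup>2
      = (1 / real n)\<^sup>2 * (norm (\<Sum>i=1..n. local_grad i x - local_grad i xs))\<^sup>2"
    by (simp add: power_divide)
  also have "\<dots> \<le> (1 / real n)\<^sup>2 *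
      (real (card {1..n}) * (\<Sum>i=1..n. (norm (local_grad i x - local_grad i xs))\<^sup>2))"
    by (intro mult_left_mono norm_sum_power2_le) auto
  also have "\<dots> = (1 / real n) * (\<Sum>i=1..n. (norm (local_grad i x - local_grad i xs))\<^sup>2)"
    using n by (simp add: power2_eq_square)
  also have "\<dots> \<le> (1 / real n) * (\<Sum>i=1..n. (1 / real m) * (\<Sum>l=1..m. deviation i l x))"
    by (intro mult_left_mono sum_mono norm_local_grad_diff) auto
  also have "\<dots> = (1 / (real n * real m)) * (\<Sum>i=1..n. \<Sum>l=1..m. deviation i l x)"
    by (simp add: sum_distrib_left)
  also have "\<dots> \<le> (1 / (real n * real m)) * (2 * L * real n * real m * gap x)"
    by (intro mult_left_mono sum_deviation_le) auto
  finally show ?thesis using n m by simp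
qed

end

section \<open>Independent sources of randomness\<close>

lemma sigma_algebra_preimages:
  assumes "X \<in> measurable M N"
  shows "sigma_algebra (space M) (preimages M N X)"
proof -
  have "sets (vimage_algebra (space M) X N) = preimages M N X"
    using assms unfolding preimages_def by (intro sets_vimage_algebra2) (auto simp: measurable_def)
  then show ?thesis
    using sets.sigma_algebra_axioms[of "vimage_algebra (space M) X N"] by simp
qed

lemma measure_uniform_draw:
  assumes X: "X \<in> measurable M (count_space I)"
    and law: "distr M (count_space I) X = uniform_count_measure I"
    and I: "finite I" "l \<in> I"
  shows "measure M {p \<in> space M. X p = l} = 1 / real (card I)"
proof -
  have "measure M {p \<in> space M. X p = l} = measure (distr M (count_space I) X) {l}"
    using X I by (subst measure_distr) (auto intro!: arg_cong[where f="measure M"])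
  also have "\<dots> = 1 / real (card I)"
    unfolding law using I by (simp add: measure_uniform_count_measure)
  finally show ?thesis .
qed

text \<open>
  A family of independent \<open>\<sigma>\<close>-algebras, one for each source of randomness. For a set \<open>C\<close> of
  sources, \<open>known C\<close> below is the information that they carry together; being measurable with
  respect to it replaces conditioning on the past of an algorithm. Conditional expectations are
  avoided: a draw is used only through its independence of \<open>known C\<close> when its own source is
  outside \<open>C\<close>.
\<close>

locale independent_sources = prob_space M for M :: "'o measure" +
  fixes E :: "'d \<Rightarrow> 'o set set" and D :: "'d set"
  assumes indep_sources: "indep_sets E D"
    and sigma_algebra_source: "d \<in> D \<Longrightarrow> sigma_algebra (space M) (E d)"
begin

definition known :: "'d set \<Rightarrow> 'o measure" where
  "known C = sigma (space M) (\<Union>d\<in>C. E d)"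

definition drawn :: "'d \<Rightarrow> 'b measure \<Rightarrow> ('o \<Rightarrow> 'b) \<Rightarrow> bool" where
  "drawn d N X \<longleftrightarrow> d \<in> D \<and> X \<in> measurable M N \<and> preimages M N X \<subseteq> E d"

text \<open>
  Square-integrable functions of the sources in \<open>C\<close>. The inclusion \<open>C \<subseteq> D\<close> is part of the
  definition because \<open>known C\<close> is guaranteed to consist of events only then.
\<close>

definition L2 :: "'d set \<Rightarrow> ('o \<Rightarrow> 'b::euclidean_space) \<Rightarrow> bool" where
  "L2 C Y \<longleftrightarrow> C \<subseteq> D \<and> Y \<in> borel_measurable (known C) \<and> integrable M (\<lambda>p. (norm (Y p))\<^sup>2)"

lemma source_events: "d \<in> D \<Longrightarrow> E d \<subseteq> events"
  using indep_sources by (auto simp: indep_sets_def)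

lemma source_subset: "d \<in> D \<Longrightarrow> E d \<subseteq> Pow (space M)"
  using source_events sets.space_closed by blast

lemma space_known [simp]: "space (known C) = space M"
  by (simp add: known_def space_measure_of_conv)

lemma sets_known:
  assumes "C \<subseteq> D"
  shows "sets (known C) = sigma_sets (space M) (\<Union>d\<in>C. E d)"
  unfolding known_def using assms source_subset by (intro sets_measure_of) blast

lemma sets_known_mono:
  assumes "C \<subseteq> C'" "C' \<subseteq> D"
  shows "sets (known C) \<subseteq> sets (known C')"
  using assms by (subst (1 2) sets_known) (auto intro!: sigma_sets_mono')

lemma sets_known_events:
  assumes "C \<subseteq> D"
  shows "sets (known C) \<subseteq> events"
  using assms source_events by (subst sets_known) (auto intro!: sets.sigma_sets_subset)

lemma measurable_known_mono:
  assumes "X \<in> measurable (known C) N" "C \<subseteq> C'" "C' \<subseteq> D"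
  shows "X \<in> measurable (known C') N"
  using assms sets_known_mono[OF assms(2,3)] by (auto simp: measurable_def)

lemma measurable_known:
  assumes "X \<in> measurable (known C) N" "C \<subseteq> D"
  shows "X \<in> measurable M N"
  using assms sets_known_events[OF assms(2)] by (auto simp: measurable_def)

lemma drawn_measurable_known:
  assumes "drawn d N X" "d \<in> C" "C \<subseteq> D"
  shows "X \<in> measurable (known C) N"
proof (rule measurableI)
  show "X p \<in> space N" if "p \<in> space (known C)" for p
    using assms(1) that by (auto simp: drawn_def measurable_def)
  show "X -` A \<inter> space (known C) \<in> sets (known C)" if "A \<in> sets N" for A
    using assms that unfolding sets_known[OF assms(3)]
    by (auto simp: drawn_def preimages_def intro!: sigma_sets.Basic)
qed

lemma indep_set_known:
  assumes "C \<subseteq> D" "d \<in> D" "d \<notin> C"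
  shows "indep_set (E d) (sets (known C))"
proof -
  let ?I = "case_bool {d} C"
  have "indep_sets (\<lambda>b. sigma_sets (space M) (\<Union>i\<in>?I b. E i)) UNIV"
  proof (rule indep_sets_collect_sigma)
    show "indep_sets E (\<Union>b\<in>UNIV. ?I b)"
      by (rule indep_sets_mono_index[OF _ indep_sources]) (use assms in \<open>auto split: bool.splits\<close>)
    show "Int_stable (E i)" if "i \<in> ?I b" for i b
    proof -
      have "i \<in> D" using that assms by (auto split: bool.splits)
      then interpret sigma_algebra "space M" "E i" by (rule sigma_algebra_source)
      show ?thesis by (auto simp: Int_stable_def)
    qed
    show "disjoint_family ?I"
      using assms by (auto simp: disjoint_family_on_def split: bool.splits)
  qed
  then show ?thesis
    unfolding indep_set_def
    by (rule indep_sets_mono_sets) (auto simp: sets_known[OF assms(1)] split: bool.splits)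
qed

text \<open>
  Independence for random elements of two different types: on rectangles the joint law
  factorizes by independence, and rectangles determine a \<open>\<sigma>\<close>-finite product measure. This is what
  allows Fubini's theorem to integrate out a fresh draw.
\<close>

lemma distr_drawn_known:
  assumes X: "drawn d N X" and Y: "Y \<in> measurable (known C) N'" and C: "C \<subseteq> D" "d \<notin> C"
  shows "distr M (N \<Otimes>\<^sub>M N') (\<lambda>p. (X p, Y p)) = distr M N X \<Otimes>\<^sub>M distr M N' Y"
proof (rule pair_measure_eqI[symmetric])
  have d: "d \<in> D" and pre: "preimages M N X \<subseteq> E d" and [measurable]: "X \<in> measurable M N"
    using X by (auto simp: drawn_def)
  have [measurable]: "Y \<in> measurable M N'" by (rule measurable_known[OF Y C(1)])
  show "sigma_finite_measure (distr M N X)" "sigma_finite_measure (distr M N' Y)"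
    by (intro prob_space_imp_sigma_finite prob_space_distr; simp)+
  show "sets (distr M N X \<Otimes>\<^sub>M distr M N' Y) = sets (distr M (N \<Otimes>\<^sub>M N') (\<lambda>p. (X p, Y p)))"
    by simp
  fix A B assume "A \<in> sets (distr M N X)" "B \<in> sets (distr M N' Y)"
  then have [measurable]: "A \<in> sets N" "B \<in> sets N'" by auto
  have "X -` A \<inter> space M \<in> E d" using pre \<open>A \<in> sets N\<close> unfolding preimages_def by blast
  moreover have "Y -` B \<inter> space M \<in> sets (known C)" using measurable_sets[OF Y] by simp
  ultimately have "prob ((X -` A \<inter> space M) \<inter> (Y -` B \<inter> space M))
      = prob (X -` A \<inter> space M) * prob (Y -` B \<inter> space M)"
    by (rule indep_setD[OF indep_set_known[OF C(1) d C(2)]])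
  moreover have "(\<lambda>p. (X p, Y p)) -` (A \<times> B) \<inter> space M = (X -` A \<inter> space M) \<inter> (Y -` B \<inter> space M)"
    by auto
  ultimately show "emeasure (distr M N X) A * emeasure (distr M N' Y) B
      = emeasure (distr M (N \<Otimes>\<^sub>M N') (\<lambda>p. (X p, Y p))) (A \<times> B)"
    by (simp add: emeasure_distr emeasure_eq_measure ennreal_mult'')
qed

lemma drawn_compose:
  assumes "drawn d N X" "g \<in> measurable N N'"
  shows "drawn d N' (\<lambda>p. g (X p))"
proof -
  have "(\<lambda>p. g (X p)) -` A \<inter> space M \<in> preimages M N X" if "A \<in> sets N'" for A
  proof -
    have "(\<lambda>p. g (X p)) -` A \<inter> space M = X -` (g -` A \<inter> space N) \<inter> space M"
      using assms(1) by (auto simp: drawn_def measurable_def)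
    then show ?thesis using measurable_sets[OF assms(2) that] unfolding preimages_def by blast
  qed
  then show ?thesis
    using assms unfolding drawn_def preimages_def[of M N']
    by (auto intro: measurable_compose)
qed

lemma indep_var_drawn_known:
  assumes "drawn d N X" "Y \<in> measurable (known C) N'" "C \<subseteq> D" "d \<notin> C"
  shows "indep_var N X N' Y"
proof -
  have d: "d \<in> D" and X: "X \<in> measurable M N" and pre: "preimages M N X \<subseteq> E d"
    using assms(1) by (auto simp: drawn_def)
  have Y: "Y \<in> measurable M N'" by (rule measurable_known[OF assms(2,3)])
  interpret sigma_algebra "space M" "E d" by (rule sigma_algebra_source[OF d])
  have 1: "sigma_sets (space M) {X -` A \<inter> space M |A. A \<in> sets N} \<subseteq> E d"
    using pre by (intro sigma_sets_subset) (simp add: preimages_def)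
  have 2: "sigma_sets (space M) {Y -` A \<inter> space M |A. A \<in> sets N'} \<subseteq> sets (known C)"
  proof -
    have "sigma_sets (space (known C)) {Y -` A \<inter> space M |A. A \<in> sets N'} \<subseteq> sets (known C)"
      using measurable_sets[OF assms(2)] by (intro sets.sigma_sets_subset) auto
    then show ?thesis by simp
  qed
  have "indep_set (sigma_sets (space M) {X -` A \<inter> space M |A. A \<in> sets N})
      (sigma_sets (space M) {Y -` A \<inter> space M |A. A \<in> sets N'})"
    using indep_set_known[OF assms(3) d assms(4)] 1 2
    unfolding indep_sets2_eq by blast
  with X Y show ?thesis unfolding indep_var_eq by blast
qed

lemma expectation_drawn_mult:
  fixes Z :: "'o \<Rightarrow> real"
  assumes "drawn d N X" "g \<in> borel_measurable N" "integrable M (\<lambda>p. g (X p))"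
    and "Z \<in> borel_measurable (known C)" "integrable M Z" "C \<subseteq> D" "d \<notin> C"
  shows "integrable M (\<lambda>p. g (X p) * Z p)"
    and "(\<integral>p. g (X p) * Z p \<partial>M) = (\<integral>p. g (X p) \<partial>M) * (\<integral>p. Z p \<partial>M)"
proof -
  have "indep_var borel (\<lambda>p. g (X p)) borel Z"
    by (rule indep_var_drawn_known[OF drawn_compose[OF assms(1,2)] assms(4,6,7)])
  from indep_var_integrable[OF this assms(3,5)] indep_var_lebesgue_integral[OF this assms(3,5)]
  show "integrable M (\<lambda>p. g (X p) * Z p)"
    and "(\<integral>p. g (X p) * Z p \<partial>M) = (\<integral>p. g (X p) \<partial>M) * (\<integral>p. Z p \<partial>M)" by auto
qed

text \<open>
  A coin of bias \<open>\<theta>\<close>, tossed independently of \<open>Y\<close> and \<open>Z\<close>, mixes their expectations: write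
  the choice as \<open>Z\<close> plus the indicator times the difference.
\<close>

lemma expectation_if_drawn:
  fixes Y Z :: "'o \<Rightarrow> real"
  assumes X: "drawn d N X" and P: "Measurable.pred N P"
    and prob: "prob {p \<in> space M. P (X p)} = \<theta>"
    and Y: "Y \<in> borel_measurable (known C)" "integrable M Y"
    and Z: "Z \<in> borel_measurable (known C)" "integrable M Z"
    and C: "C \<subseteq> D" "d \<notin> C"
  shows "(\<integral>p. (if P (X p) then Y p else Z p) \<partial>M) = \<theta> * (\<integral>p. Y p \<partial>M) + (1 - \<theta>) * (\<integral>p. Z p \<partial>M)"
proof -
  have [measurable]: "X \<in> measurable M N" using X by (simp add: drawn_def)
  note [measurable] = P
  let ?g = "\<lambda>x. of_bool (P x) :: real"
  have g: "?g \<in> borel_measurable N" by measurable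
  have gi: "integrable M (\<lambda>p. ?g (X p))"
    by (rule integrable_const_bound[where B=1]) auto
  have \<theta>: "(\<integral>p. ?g (X p) \<partial>M) = \<theta>"
  proof -
    have "(\<integral>p. ?g (X p) \<partial>M) = (\<integral>p. indicator {p \<in> space M. P (X p)} p \<partial>M)"
      by (intro Bochner_Integration.integral_cong) (auto simp: indicator_def)
    then show ?thesis using prob by simp
  qed
  have YZ: "(\<lambda>p. Y p - Z p) \<in> borel_measurable (known C)" "integrable M (\<lambda>p. Y p - Z p)"
    using Y Z by auto
  have "(\<integral>p. (if P (X p) then Y p else Z p) \<partial>M) = (\<integral>p. ?g (X p) * (Y p - Z p) + Z p \<partial>M)"
    by (intro Bochner_Integration.integral_cong) auto
  also have "\<dots> = \<theta> * ((\<integral>p. Y p \<partial>M) - (\<integral>p. Z p \<partial>M)) + (\<integral>p. Z p \<partial>M)"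
    using expectation_drawn_mult[OF X g gi YZ C] Y Z \<theta> by simp
  finally show ?thesis by (simp add: algebra_simps)
qed

text \<open>
  An index that is uniform and independent of all candidates averages their expectations:
  decompose along the finitely many values of the index.
\<close>

lemma expectation_select_drawn:
  fixes Z :: "nat \<Rightarrow> 'o \<Rightarrow> real"
  assumes J: "drawn d (count_space I) J" and I: "finite I"
    and prob: "\<And>l. l \<in> I \<Longrightarrow> prob {p \<in> space M. J p = l} = \<theta>"
    and Z: "\<And>l. l \<in> I \<Longrightarrow> Z l \<in> borel_measurable (known C)" "\<And>l. l \<in> I \<Longrightarrow> integrable M (Z l)"
    and C: "C \<subseteq> D" "d \<notin> C"
  shows "integrable M (\<lambda>p. Z (J p) p)"
    and "(\<integral>p. Z (J p) p \<partial>M) = \<theta> * (\<Sum>l\<in>I. \<integral>p. Z l p \<partial>M)"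
proof -
  have Jm [measurable]: "J \<in> measurable M (count_space I)" using J by (simp add: drawn_def)
  have eq: "Z (J p) p = (\<Sum>l\<in>I. of_bool (J p = l) * Z l p)" if "p \<in> space M" for p
  proof -
    have "J p \<in> I" using Jm that by (auto simp: measurable_def)
    have "(\<Sum>l\<in>I. of_bool (J p = l) * Z l p) = (\<Sum>l\<in>I. if J p = l then Z l p else 0)"
      by (intro sum.cong) auto
    then show ?thesis using I \<open>J p \<in> I\<close> by simp
  qed
  have gi: "integrable M (\<lambda>p. of_bool (J p = l) :: real)" for l
  proof (rule integrable_const_bound[where B=1])
    show "(\<lambda>p. of_bool (J p = l) :: real) \<in> borel_measurable M"
      by (rule measurable_compose[OF Jm]) simp
  qed auto
  have \<theta>: "(\<integral>p. of_bool (J p = l) \<partial>M) = \<theta>" if "l \<in> I" for l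
  proof -
    have "(\<integral>p. of_bool (J p = l) \<partial>M) = (\<integral>p. (indicator {p \<in> space M. J p = l} p :: real) \<partial>M)"
      by (intro Bochner_Integration.integral_cong) (auto simp: indicator_def)
    then show ?thesis using prob[OF that] by simp
  qed
  have int: "integrable M (\<lambda>p. of_bool (J p = l) * Z l p)"
    and val: "(\<integral>p. of_bool (J p = l) * Z l p \<partial>M) = \<theta> * (\<integral>p. Z l p \<partial>M)" if "l \<in> I" for l
    using expectation_drawn_mult[OF J, of "\<lambda>x. of_bool (x = l)", OF _ gi Z(1,2)[OF that] C] \<theta>[OF that]
    by auto
  have cong: "integrable M (\<lambda>p. Z (J p) p) = integrable M (\<lambda>p. \<Sum>l\<in>I. of_bool (J p = l) * Z l p)"
    using eq by (intro Bochner_Integration.integrable_cong) auto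
  show "integrable M (\<lambda>p. Z (J p) p)" unfolding cong using int by auto
  have "(\<integral>p. Z (J p) p \<partial>M) = (\<integral>p. (\<Sum>l\<in>I. of_bool (J p = l) * Z l p) \<partial>M)"
    using eq by (intro Bochner_Integration.integral_cong) auto
  also have "\<dots> = (\<Sum>l\<in>I. \<integral>p. of_bool (J p = l) * Z l p \<partial>M)"
    using int by (intro Bochner_Integration.integral_sum) auto
  also have "\<dots> = \<theta> * (\<Sum>l\<in>I. \<integral>p. Z l p \<partial>M)"
    using val by (simp add: sum_distrib_left)
  finally show "(\<integral>p. Z (J p) p \<partial>M) = \<theta> * (\<Sum>l\<in>I. \<integral>p. Z l p \<partial>M)" .
qed

section \<open>Square-integrable random vectors\<close>

lemma L2_subset: "L2 C Y \<Longrightarrow> C \<subseteq> D"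
  by (simp add: L2_def)

lemma L2_measurable_known: "L2 C Y \<Longrightarrow> Y \<in> borel_measurable (known C)"
  by (simp add: L2_def)

lemma L2_measurable: "L2 C Y \<Longrightarrow> Y \<in> borel_measurable M"
  using measurable_known by (auto simp: L2_def)

lemma L2_integrable: "L2 C Y \<Longrightarrow> integrable M (\<lambda>p. (norm (Y p))\<^sup>2)"
  by (simp add: L2_def)

lemma L2_mono: "L2 C Y \<Longrightarrow> C \<subseteq> C' \<Longrightarrow> C' \<subseteq> D \<Longrightarrow> L2 C' Y"
  using measurable_known_mono by (auto simp: L2_def)

lemma L2_bound:
  fixes Z :: "'o \<Rightarrow> 'b::euclidean_space"
  assumes C: "C \<subseteq> D" and Z: "Z \<in> borel_measurable (known C)" and g: "integrable M g"
    and le: "\<And>p. p \<in> space M \<Longrightarrow> (norm (Z p))\<^sup>2 \<le> g p"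
  shows "L2 C Z"
proof -
  have [measurable]: "Z \<in> borel_measurable M" by (rule measurable_known[OF Z C])
  have "integrable M (\<lambda>p. (norm (Z p))\<^sup>2)"
  proof (rule Bochner_Integration.integrable_bound[OF g])
    show "AE p in M. norm ((norm (Z p))\<^sup>2) \<le> norm (g p)"
      using le by (intro AE_I2) fastforce
  qed measurable
  with C Z show ?thesis by (simp add: L2_def)
qed

lemma L2_const: "C \<subseteq> D \<Longrightarrow> L2 C (\<lambda>p. c)"
  by (simp add: L2_def)

lemma L2_scaleR:
  assumes "L2 C Y"
  shows "L2 C (\<lambda>p. r *\<^sub>R Y p)"
  using assms by (auto simp: L2_def power_mult_distrib)

lemma L2_add:
  assumes "L2 C Y" "L2 C Z"
  shows "L2 C (\<lambda>p. Y p + Z p)"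
  using assms norm_add_power2_le
  by (intro L2_bound[where g="\<lambda>p. 2 * (norm (Y p))\<^sup>2 + 2 * (norm (Z p))\<^sup>2"]) (auto simp: L2_def)

lemma L2_diff:
  assumes "L2 C Y" "L2 C Z"
  shows "L2 C (\<lambda>p. Y p - Z p)"
  using L2_add[OF assms(1) L2_scaleR[OF assms(2), of "-1"]] by simp

lemma L2_sum:
  assumes "C \<subseteq> D" "\<And>i. i \<in> I \<Longrightarrow> L2 C (Y i)"
  shows "L2 C (\<lambda>p. \<Sum>i\<in>I. Y i p)"
proof (cases "finite I")
  case True
  then show ?thesis using assms(2)
    by (induction I rule: finite_induct) (auto intro: L2_add L2_const[OF assms(1)])
qed (simp add: L2_const[OF assms(1)])

lemma L2_if:
  assumes Y: "L2 C Y" "L2 C Z" and P: "Measurable.pred (known C) P"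
  shows "L2 C (\<lambda>p. if P p then Y p else Z p)"
proof (rule L2_bound[where g="\<lambda>p. (norm (Y p))\<^sup>2 + (norm (Z p))\<^sup>2"])
  have [measurable]: "Y \<in> borel_measurable (known C)" "Z \<in> borel_measurable (known C)"
    using Y by (auto simp: L2_def)
  note [measurable] = P
  show "(\<lambda>p. if P p then Y p else Z p) \<in> borel_measurable (known C)" by measurable
qed (use Y in \<open>auto simp: L2_def\<close>)

lemma L2_select:
  assumes J: "J \<in> measurable (known C) (count_space I)" and I: "finite I" and C: "C \<subseteq> D"
    and Y: "\<And>l. l \<in> I \<Longrightarrow> L2 C (Y l)"
  shows "L2 C (\<lambda>p. Y (J p) p)"
proof (rule L2_bound[where g="\<lambda>p. \<Sum>l\<in>I. (norm (Y l p))\<^sup>2"])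
  show "(\<lambda>p. Y (J p) p) \<in> borel_measurable (known C)"
    by (rule measurable_compose_countable'[OF _ J])
      (use Y I in \<open>auto simp: L2_def countable_finite\<close>)
  show "(norm (Y (J p) p))\<^sup>2 \<le> (\<Sum>l\<in>I. (norm (Y l p))\<^sup>2)" if "p \<in> space M" for p
  proof -
    have "J p \<in> I" using J that by (auto simp: measurable_def)
    then show ?thesis using I by (intro member_le_sum) auto
  qed
qed (use Y C in \<open>auto simp: L2_def\<close>)

lemma L2_Lipschitz:
  fixes \<phi> :: "'b::euclidean_space \<Rightarrow> 'c::euclidean_space"
  assumes Y: "L2 C Y" and lip: "\<And>y z. norm (\<phi> y - \<phi> z) \<le> K * norm (y - z)"
  shows "L2 C (\<lambda>p. \<phi> (Y p))"
proof (rule L2_bound[where g="\<lambda>p. 2 * (K\<^sup>2 * (norm (Y p))\<^sup>2) + 2 * (norm (\<phi> 0))\<^sup>2"])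
  have "continuous_on UNIV \<phi>"
  proof (rule lipschitz_on_continuous_on)
    show "(max K 0)-lipschitz_on UNIV \<phi>"
    proof (rule lipschitz_onI)
      fix y z
      have "norm (\<phi> y - \<phi> z) \<le> K * norm (y - z)" by (rule lip)
      also have "\<dots> \<le> max K 0 * norm (y - z)" by (intro mult_right_mono) auto
      finally show "dist (\<phi> y) (\<phi> z) \<le> max K 0 * dist y z" by (simp add: dist_norm)
    qed simp
  qed
  then have "\<phi> \<in> borel_measurable borel" by (rule borel_measurable_continuous_onI)
  then show "(\<lambda>p. \<phi> (Y p)) \<in> borel_measurable (known C)"
    using Y by (auto simp: L2_def intro: measurable_compose)
  show "(norm (\<phi> (Y p)))\<^sup>2 \<le> 2 * (K\<^sup>2 * (norm (Y p))\<^sup>2) + 2 * (norm (\<phi> 0))\<^sup>2" for p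
  proof -
    have "(norm (\<phi> (Y p)))\<^sup>2 \<le> 2 * (norm (\<phi> (Y p) - \<phi> 0))\<^sup>2 + 2 * (norm (\<phi> 0))\<^sup>2"
      using norm_add_power2_le[of "\<phi> (Y p) - \<phi> 0" "\<phi> 0"] by simp
    moreover have "(norm (\<phi> (Y p) - \<phi> 0))\<^sup>2 \<le> (K * norm (Y p))\<^sup>2"
      using lip[of "Y p" 0] by (intro power_mono) auto
    ultimately show ?thesis by (simp add: power_mult_distrib)
  qed
qed (use Y in \<open>auto simp: L2_def\<close>)

lemma integrable_inner:
  fixes Y Z :: "'o \<Rightarrow> 'b::euclidean_space"
  assumes Y: "L2 C Y" and Z: "L2 C' Z"
  shows "integrable M (\<lambda>p. Y p \<bullet> Z p)"
proof (rule Bochner_Integration.integrable_bound[where f="\<lambda>p. (norm (Y p))\<^sup>2 + (norm (Z p))\<^sup>2"])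
  have [measurable]: "Y \<in> borel_measurable M" "Z \<in> borel_measurable M"
    using Y Z L2_measurable by auto
  show "(\<lambda>p. Y p \<bullet> Z p) \<in> borel_measurable M" by measurable
  show "AE p in M. norm (Y p \<bullet> Z p) \<le> norm ((norm (Y p))\<^sup>2 + (norm (Z p))\<^sup>2)"
  proof (rule AE_I2)
    fix p
    have "norm (Y p \<bullet> Z p) \<le> norm (Y p) * norm (Z p)" by (simp add: Cauchy_Schwarz_ineq2)
    also have "\<dots> \<le> (norm (Y p))\<^sup>2 + (norm (Z p))\<^sup>2"
      using sum_squares_bound[of "norm (Y p)" "norm (Z p)"]
        mult_nonneg_nonneg[OF norm_ge_zero norm_ge_zero, of "Y p" "Z p"] by linarith
    finally show "norm (Y p \<bullet> Z p) \<le> norm ((norm (Y p))\<^sup>2 + (norm (Z p))\<^sup>2)" by simp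
  qed
qed (use Y Z in \<open>auto simp: L2_def\<close>)

lemma expectation_norm_add:
  fixes Y Z :: "'o \<Rightarrow> 'b::euclidean_space"
  assumes Y: "L2 C Y" and Z: "L2 C' Z" and orth: "(\<integral>p. Y p \<bullet> Z p \<partial>M) = 0"
  shows "(\<integral>p. (norm (Y p + Z p))\<^sup>2 \<partial>M) = (\<integral>p. (norm (Y p))\<^sup>2 \<partial>M) + (\<integral>p. (norm (Z p))\<^sup>2 \<partial>M)"
proof -
  have "(\<integral>p. (norm (Y p + Z p))\<^sup>2 \<partial>M)
      = (\<integral>p. ((norm (Y p))\<^sup>2 + (norm (Z p))\<^sup>2) + 2 * (Y p \<bullet> Z p) \<partial>M)"
    by (intro Bochner_Integration.integral_cong)
      (auto simp: power2_norm_eq_inner inner_add_left inner_add_right inner_commute)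
  also have "\<dots> = (\<integral>p. (norm (Y p))\<^sup>2 \<partial>M) + (\<integral>p. (norm (Z p))\<^sup>2 \<partial>M) + 2 * (\<integral>p. Y p \<bullet> Z p \<partial>M)"
    using L2_integrable[OF Y] L2_integrable[OF Z] integrable_inner[OF Y Z] by simp
  finally show ?thesis using orth by simp
qed

lemma expectation_inner_sum_right:
  fixes Y :: "'o \<Rightarrow> 'b::euclidean_space"
  assumes "L2 C Y" "\<And>i. i \<in> I \<Longrightarrow> L2 (C' i) (Z i)"
  shows "(\<integral>p. Y p \<bullet> (\<Sum>i\<in>I. Z i p) \<partial>M) = (\<Sum>i\<in>I. \<integral>p. Y p \<bullet> Z i p \<partial>M)"
  unfolding inner_sum_right
  using integrable_inner[OF assms(1) assms(2)] by (intro Bochner_Integration.integral_sum) auto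

lemma expectation_norm_sum_orthogonal:
  fixes Y :: "'i \<Rightarrow> 'o \<Rightarrow> 'b::euclidean_space"
  assumes "finite I" "C \<subseteq> D" and "\<And>i. i \<in> I \<Longrightarrow> L2 C (Y i)"
    and "\<And>i k. i \<in> I \<Longrightarrow> k \<in> I \<Longrightarrow> i \<noteq> k \<Longrightarrow> (\<integral>p. Y i p \<bullet> Y k p \<partial>M) = 0"
  shows "(\<integral>p. (norm (\<Sum>i\<in>I. Y i p))\<^sup>2 \<partial>M) = (\<Sum>i\<in>I. \<integral>p. (norm (Y i p))\<^sup>2 \<partial>M)"
  using assms(1,3,4)
proof (induction I rule: finite_induct)
  case (insert i I)
  have "(\<integral>p. Y i p \<bullet> (\<Sum>k\<in>I. Y k p) \<partial>M) = (\<Sum>k\<in>I. \<integral>p. Y i p \<bullet> Y k p \<partial>M)"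
    using insert.prems by (intro expectation_inner_sum_right[where C=C and C'="\<lambda>_. C"]) auto
  also have "\<dots> = 0"
    using insert.prems(2) insert.hyps by (intro sum.neutral) auto
  finally have orth: "(\<integral>p. Y i p \<bullet> (\<Sum>k\<in>I. Y k p) \<partial>M) = 0" .
  have "L2 C (Y i)" "L2 C (\<lambda>p. \<Sum>k\<in>I. Y k p)"
    using insert.prems by (auto intro!: L2_sum assms(2))
  from expectation_norm_add[OF this orth] insert show ?case by simp
qed simp

section \<open>Quantization with a fresh seed\<close>

context
  fixes \<omega> :: real and S :: "'s measure" and Q :: "'s \<Rightarrow> 'a::euclidean_space \<Rightarrow> 'a"
    and d :: 'd and s :: "'o \<Rightarrow> 's" and C :: "'d set" and Y :: "'o \<Rightarrow> 'a"
  assumes Q: "quantization_operator \<omega> S Q"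
    and s: "drawn d S s" and law: "distr M S s = S"
    and fresh: "d \<notin> C" and Y: "L2 C Y"
begin

lemma measurable_quantizer: "(\<lambda>(s, x). Q s x) \<in> borel_measurable (S \<Otimes>\<^sub>M borel)"
  using Q by (simp add: quantization_operator_def)

lemma quantized_measurable_known:
  assumes "C \<subseteq> C'" "d \<in> C'" "C' \<subseteq> D"
  shows "(\<lambda>p. Q (s p) (Y p)) \<in> borel_measurable (known C')"
proof -
  have "(\<lambda>p. (s p, Y p)) \<in> measurable (known C') (S \<Otimes>\<^sub>M borel)"
    using drawn_measurable_known[OF s assms(2,3)]
      measurable_known_mono[OF L2_measurable_known[OF Y] assms(1,3)] by simp
  from measurable_compose[OF this measurable_quantizer] show ?thesis by simp
qed

text \<open>
  The joint law of the seed and the input is a product, so the seed can be integrated first, with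
  the input held constant. There the defining bound of the quantizer applies.
\<close>

lemma expectation_norm_quantized:
  shows "integrable M (\<lambda>p. (norm (Q (s p) (Y p)))\<^sup>2)"
    and "(\<integral>p. (norm (Q (s p) (Y p)))\<^sup>2 \<partial>M) \<le> (\<omega> + 1) * (\<integral>p. (norm (Y p))\<^sup>2 \<partial>M)"
proof -
  note [measurable] = measurable_quantizer
  have \<omega>: "\<omega> \<ge> 0" and S: "prob_space S"
    and int: "\<And>x. integrable S (\<lambda>s. (norm (Q s x))\<^sup>2)"
    and le: "\<And>x. (\<integral>s. (norm (Q s x))\<^sup>2 \<partial>S) \<le> (\<omega> + 1) * (norm x)\<^sup>2"
    using Q by (auto simp: quantization_operator_def)
  have [measurable]: "s \<in> measurable M S" using s by (simp add: drawn_def)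
  have [measurable]: "Y \<in> borel_measurable M" by (rule L2_measurable[OF Y])
  let ?N = "distr M borel Y"
  interpret S: prob_space S by (rule S)
  interpret N: prob_space ?N by (rule prob_space_distr) simp
  interpret P: pair_prob_space S ?N ..
  have joint: "distr M (S \<Otimes>\<^sub>M borel) (\<lambda>p. (s p, Y p)) = S \<Otimes>\<^sub>M ?N"
    using distr_drawn_known[OF s L2_measurable_known[OF Y] L2_subset[OF Y] fresh] law by simp
  let ?q = "\<lambda>z. ennreal ((norm (case z of (s, x) \<Rightarrow> Q s x))\<^sup>2)"
  have q: "?q \<in> borel_measurable (S \<Otimes>\<^sub>M ?N)" by measurable
  have "(\<integral>\<^sup>+p. ennreal ((norm (Q (s p) (Y p)))\<^sup>2) \<partial>M)
      = (\<integral>\<^sup>+z. ?q z \<partial>distr M (S \<Otimes>\<^sub>M borel) (\<lambda>p. (s p, Y p)))"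
    by (subst nn_integral_distr) auto
  also have "\<dots> = (\<integral>\<^sup>+x. \<integral>\<^sup>+s. ?q (s, x) \<partial>S \<partial>?N)"
    unfolding joint by (rule P.nn_integral_snd[OF q, symmetric])
  also have "\<dots> \<le> (\<integral>\<^sup>+x. ennreal ((\<omega> + 1) * (norm x)\<^sup>2) \<partial>?N)"
    by (intro nn_integral_mono) (auto simp: nn_integral_eq_integral[OF int] intro!: ennreal_leI le)
  also have "\<dots> = (\<integral>\<^sup>+p. ennreal ((\<omega> + 1) * (norm (Y p))\<^sup>2) \<partial>M)"
    by (subst nn_integral_distr) auto
  also have "\<dots> = ennreal (\<integral>p. (\<omega> + 1) * (norm (Y p))\<^sup>2 \<partial>M)"
    using L2_integrable[OF Y] \<omega> by (intro nn_integral_eq_integral) auto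
  also have "\<dots> = ennreal ((\<omega> + 1) * (\<integral>p. (norm (Y p))\<^sup>2 \<partial>M))" by simp
  finally have bound: "(\<integral>\<^sup>+p. ennreal ((norm (Q (s p) (Y p)))\<^sup>2) \<partial>M)
      \<le> ennreal ((\<omega> + 1) * (\<integral>p. (norm (Y p))\<^sup>2 \<partial>M))" .
  have Qm: "(\<lambda>p. Q (s p) (Y p)) \<in> borel_measurable M"
    by (rule measurable_known[OF quantized_measurable_known[of "insert d C"]])
      (use s L2_subset[OF Y] in \<open>auto simp: drawn_def\<close>)
  show i: "integrable M (\<lambda>p. (norm (Q (s p) (Y p)))\<^sup>2)"
    using Qm bound by (intro integrableI_bounded) (auto intro: le_less_trans)
  show "(\<integral>p. (norm (Q (s p) (Y p)))\<^sup>2 \<partial>M) \<le> (\<omega> + 1) * (\<integral>p. (norm (Y p))\<^sup>2 \<partial>M)"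
    using bound \<omega> unfolding nn_integral_eq_integral[OF i, simplified]
    by (subst (asm) ennreal_le_iff) auto
qed

lemma L2_quantized:
  assumes "C \<subseteq> C'" "d \<in> C'" "C' \<subseteq> D"
  shows "L2 C' (\<lambda>p. Q (s p) (Y p))"
  using assms quantized_measurable_known expectation_norm_quantized(1) by (simp add: L2_def)

text \<open>
  Unbiasedness of the quantizer, tested against everything that does not involve the seed. The
  input and the test vector are paired so that Fubini's theorem can hold both constant while
  integrating over the seed.
\<close>

lemma expectation_inner_quantized:
  assumes Z: "L2 C Z"
  shows "(\<integral>p. Q (s p) (Y p) \<bullet> Z p \<partial>M) = (\<integral>p. Y p \<bullet> Z p \<partial>M)"
proof -
  note [measurable] = measurable_quantizer
  have S: "prob_space S"
    and int: "\<And>x. integrable S (\<lambda>s. Q s x)" and mean: "\<And>x. (\<integral>s. Q s x \<partial>S) = x"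
    using Q by (auto simp: quantization_operator_def)
  have [measurable]: "s \<in> measurable M S" using s by (simp add: drawn_def)
  have [measurable]: "Y \<in> borel_measurable M" "Z \<in> borel_measurable M"
    using L2_measurable Y Z by auto
  let ?B = "borel \<Otimes>\<^sub>M borel :: ('a \<times> 'a) measure"
  let ?N = "distr M ?B (\<lambda>p. (Y p, Z p))"
  interpret S: prob_space S by (rule S)
  interpret N: prob_space ?N by (rule prob_space_distr) simp
  interpret P: pair_prob_space S ?N ..
  have YZ: "(\<lambda>p. (Y p, Z p)) \<in> measurable (known C) ?B"
    by (intro measurable_Pair L2_measurable_known Y Z)
  have joint: "distr M (S \<Otimes>\<^sub>M ?B) (\<lambda>p. (s p, (Y p, Z p))) = S \<Otimes>\<^sub>M ?N"
    using distr_drawn_known[OF s YZ L2_subset[OF Y] fresh] law by simp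
  let ?q = "\<lambda>(s, x, z). Q s x \<bullet> z"
  have q [measurable]: "?q \<in> borel_measurable (S \<Otimes>\<^sub>M ?B)" by measurable
  have "L2 (insert d C) (\<lambda>p. Q (s p) (Y p))"
    by (rule L2_quantized) (use s L2_subset[OF Y] in \<open>auto simp: drawn_def\<close>)
  then have "integrable M (\<lambda>p. Q (s p) (Y p) \<bullet> Z p)"
    using Z by (rule integrable_inner)
  then have "integrable (distr M (S \<Otimes>\<^sub>M ?B) (\<lambda>p. (s p, (Y p, Z p)))) ?q"
    by (subst integrable_distr_eq) auto
  then have qi: "integrable (S \<Otimes>\<^sub>M ?N) (\<lambda>(s, y). ?q (s, y))" unfolding joint by simp
  have "(\<integral>p. Q (s p) (Y p) \<bullet> Z p \<partial>M)
      = (\<integral>z. ?q z \<partial>distr M (S \<Otimes>\<^sub>M ?B) (\<lambda>p. (s p, (Y p, Z p))))"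
    by (subst integral_distr) auto
  also have "\<dots> = (\<integral>y. \<integral>s. ?q (s, y) \<partial>S \<partial>?N)"
    unfolding joint using P.integral_snd[OF qi] by simp
  also have "\<dots> = (\<integral>y. fst y \<bullet> snd y \<partial>?N)"
    by (intro Bochner_Integration.integral_cong) (auto simp: int mean)
  also have "\<dots> = (\<integral>p. Y p \<bullet> Z p \<partial>M)"
    by (subst integral_distr) auto
  finally show ?thesis .
qed

end

end

section \<open>The random state of VR-DIANA\<close>

locale vr_diana_run = finite_sum_problem n m f L xs
  for n m :: nat and f :: "nat \<Rightarrow> nat \<Rightarrow> 'a::euclidean_space \<Rightarrow> real" and L :: real and xs :: 'a +
  fixes \<omega> \<alpha> \<gamma> :: real and v :: variant and k :: nat
    and S :: "'s measure" and Q :: "'s \<Rightarrow> 'a \<Rightarrow> 'a" and M :: "'o measure"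
    and u :: "nat \<Rightarrow> 'o \<Rightarrow> bool" and j :: "nat \<Rightarrow> nat \<Rightarrow> 'o \<Rightarrow> nat"
    and s :: "nat \<Rightarrow> nat \<Rightarrow> 'o \<Rightarrow> 's" and a :: "'o \<Rightarrow> nat"
    and x0 :: 'a and h0 :: "nat \<Rightarrow> 'a" and w0 :: "nat \<Rightarrow> nat \<Rightarrow> 'a"
  assumes \<omega>: "\<omega> \<ge> 0" and quantizer: "quantization_operator \<omega> S Q"
    and \<alpha>: "0 < \<alpha>" "\<alpha> \<le> 1 / (\<omega> + 1)" and \<gamma>: "0 < \<gamma>"
    and randomness: "vr_diana_randomness v n m k S M u j s a"
begin

definition source :: "draw \<Rightarrow> 'o set set" where
  "source d = (case d of
      Coin t \<Rightarrow> preimages M (count_space UNIV) (u t)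
    | Index t i \<Rightarrow> preimages M (count_space {1..m}) (j t i)
    | Seed t i \<Rightarrow> preimages M S (s t i)
    | Output \<Rightarrow> preimages M (count_space {0..<k}) a)"

sublocale independent_sources M source "draws v n"
proof -
  note r = randomness[unfolded vr_diana_randomness_def]
  interpret prob_space M using r by simp
  show "independent_sources M source (draws v n)"
  proof (intro independent_sources.intro independent_sources_axioms.intro)
    show "prob_space M" by (rule prob_space_axioms)
    show "indep_sets source (draws v n)" using r unfolding source_def by blast
    show "sigma_algebra (space M) (source d)" if "d \<in> draws v n" for d
      using that r by (auto simp: draws_def source_def intro!: sigma_algebra_preimages)
  qed
qed

text \<open>
  All draws made before round \<open>t\<close>. The index of the returned iterate is never among them, so it
  is independent of every iterate.
\<close>

definition past :: "nat \<Rightarrow> draw set" where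
  "past t = {d \<in> draws v n. case d of
      Coin r \<Rightarrow> r < t | Index r i \<Rightarrow> r < t | Seed r i \<Rightarrow> r < t | Output \<Rightarrow> False}"

text \<open>
  What determines the message of worker \<open>i\<close> in round \<open>t\<close>. The draws that the other workers make
  in the same round are left out; this makes the noises of different workers orthogonal.
\<close>

definition worker_past :: "nat \<Rightarrow> nat \<Rightarrow> draw set" where
  "worker_past t i = insert (Seed t i) (insert (Index t i) (past t))"

lemma past_subset: "past t \<subseteq> draws v n"
  by (auto simp: past_def)

lemma past_mono: "t \<le> t' \<Longrightarrow> past t \<subseteq> past t'"
  by (auto simp: past_def split: draw.splits)

lemma not_in_past [simp]:
  "Coin t \<notin> past t" "Index t i \<notin> past t" "Seed t i \<notin> past t" "Output \<notin> past t"
  by (auto simp: past_def)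

lemma Index_in_draws [simp]: "i \<in> {1..n} \<Longrightarrow> Index t i \<in> draws v n"
  by (simp add: draws_def)

lemma Seed_in_draws [simp]: "i \<in> {1..n} \<Longrightarrow> Seed t i \<in> draws v n"
  by (simp add: draws_def)

lemma Coin_in_draws: "v = LSVRG \<Longrightarrow> Coin t \<in> draws v n"
  by (simp add: draws_def)

lemma Output_in_draws: "Output \<in> draws v n"
  by (simp add: draws_def)

lemma worker_past_subset: "i \<in> {1..n} \<Longrightarrow> worker_past t i \<subseteq> past (Suc t)"
  by (auto simp: worker_past_def past_def less_Suc_eq split: draw.splits)

lemma drawn_index: "i \<in> {1..n} \<Longrightarrow> drawn (Index t i) (count_space {1..m}) (j t i)"
  using randomness by (simp add: drawn_def source_def vr_diana_randomness_def)

lemma drawn_seed: "i \<in> {1..n} \<Longrightarrow> drawn (Seed t i) S (s t i)"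
  using randomness by (simp add: drawn_def source_def vr_diana_randomness_def)

lemma distr_seed: "i \<in> {1..n} \<Longrightarrow> distr M S (s t i) = S"
  using randomness by (simp add: vr_diana_randomness_def)

lemma drawn_coin:
  assumes "v = LSVRG"
  shows "drawn (Coin t) (count_space UNIV) (u t)"
  using randomness assms Coin_in_draws[OF assms, of t]
  unfolding drawn_def source_def vr_diana_randomness_def by (simp del: One_nat_def)

lemma drawn_output: "drawn Output (count_space {0..<k}) a"
  using randomness Output_in_draws by (simp add: drawn_def source_def vr_diana_randomness_def)

lemma prob_coin: "v = LSVRG \<Longrightarrow> prob {p \<in> space M. u t p} = 1 / real m"
  using randomness by (simp add: vr_diana_randomness_def)

lemma prob_index:
  assumes "i \<in> {1..n}" "l \<in> {1..m}"
  shows "prob {p \<in> space M. j t i p = l} = 1 / real m"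
  using measure_uniform_draw[of "j t i" M "{1..m}" l] randomness assms
  by (simp add: vr_diana_randomness_def)

lemma prob_output: "t < k \<Longrightarrow> prob {p \<in> space M. a p = t} = 1 / real k"
  using measure_uniform_draw[of a M "{0..<k}" t] randomness
  by (simp add: vr_diana_randomness_def)

definition state :: "nat \<Rightarrow> 'o \<Rightarrow> 'a vrd_state" where
  "state t p = vr_diana v n m f \<alpha> \<gamma> Q x0 h0 w0 (\<lambda>t. u t p) (\<lambda>t i. j t i p) (\<lambda>t i. s t i p) t"

definition x :: "nat \<Rightarrow> 'o \<Rightarrow> 'a" where "x t p = iter (state t p)"

definition h :: "nat \<Rightarrow> nat \<Rightarrow> 'o \<Rightarrow> 'a" where "h t i p = shift (state t p) i"

definition w :: "nat \<Rightarrow> nat \<Rightarrow> nat \<Rightarrow> 'o \<Rightarrow> 'a" where "w t i l p = ref (state t p) i l"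

definition refreshed :: "nat \<Rightarrow> nat \<Rightarrow> nat \<Rightarrow> 'o \<Rightarrow> bool" where
  "refreshed t i l p = (case v of LSVRG \<Rightarrow> u t p | SAGA \<Rightarrow> j t i p = l)"

definition grad_change :: "nat \<Rightarrow> nat \<Rightarrow> nat \<Rightarrow> 'o \<Rightarrow> 'a" where
  "grad_change t i l p = grad (f i l) (x t p) - grad (f i l) (w t i l p)"

text \<open>
  The variance-reduced gradient of worker \<open>i\<close>: it has mean \<open>local_grad i (x t p)\<close> over the
  sampled index.
\<close>

definition estimator :: "nat \<Rightarrow> nat \<Rightarrow> 'o \<Rightarrow> 'a" where
  "estimator t i p = grad_change t i (j t i p) p
     + (1 / real m) *\<^sub>R (\<Sum>l=1..m. grad (f i l) (w t i l p))"

definition message :: "nat \<Rightarrow> nat \<Rightarrow> 'o \<Rightarrow> 'a" where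
  "message t i p = Q (s t i p) (estimator t i p - h t i p)"

text \<open>
  Total noise of worker \<open>i\<close>, from sampling and quantization together. The shift enters because
  the server adds it back to the decompressed message.
\<close>

definition noise :: "nat \<Rightarrow> nat \<Rightarrow> 'o \<Rightarrow> 'a" where
  "noise t i p = message t i p + h t i p - local_grad i (x t p)"

lemma x_0: "x 0 p = x0" and h_0: "h 0 i p = h0 i" and w_0: "w 0 i l p = w0 i l"
  by (simp_all add: x_def h_def w_def state_def)

lemma x_Suc: "x (Suc t) p = x t p - \<gamma> *\<^sub>R ((1 / real n) *\<^sub>R (\<Sum>i=1..n. message t i p + h t i p))"
  by (simp add: x_def h_def w_def state_def vr_diana_step_def Let_def message_def estimator_def
      grad_change_def)

lemma h_Suc: "h (Suc t) i p = h t i p + \<alpha> *\<^sub>R message t i p"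
  by (simp add: x_def h_def w_def state_def vr_diana_step_def Let_def message_def estimator_def
      grad_change_def)

lemma w_Suc: "w (Suc t) i l p = (if refreshed t i l p then x t p else w t i l p)"
  by (auto simp: x_def h_def w_def state_def vr_diana_step_def Let_def refreshed_def
      split: variant.splits)

section \<open>Square-integrability of the state\<close>

lemma L2_grad: "i \<in> {1..n} \<Longrightarrow> l \<in> {1..m} \<Longrightarrow> L2 C Y \<Longrightarrow> L2 C (\<lambda>p. grad (f i l) (Y p))"
  by (rule L2_Lipschitz[OF _ grad_Lipschitz[OF convex smooth]])

lemma L2_local_grad: "i \<in> {1..n} \<Longrightarrow> L2 C Y \<Longrightarrow> L2 C (\<lambda>p. local_grad i (Y p))"
  unfolding local_grad_def by (intro L2_scaleR L2_sum L2_grad) (auto dest: L2_subset)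

lemma L2_global_grad: "L2 C Y \<Longrightarrow> L2 C (\<lambda>p. global_grad (Y p))"
  unfolding global_grad_def by (intro L2_scaleR L2_sum L2_local_grad) (auto dest: L2_subset)

text \<open>
  The induction hypothesis under which one round preserves square-integrability. The facts
  about the pieces of a round are therefore first proved relative to it.
\<close>

definition L2_state :: "nat \<Rightarrow> bool" where
  "L2_state t \<longleftrightarrow> L2 (past t) (x t) \<and> (\<forall>i\<in>{1..n}. L2 (past t) (h t i)) \<and>
     (\<forall>i\<in>{1..n}. \<forall>l\<in>{1..m}. L2 (past t) (w t i l))"

lemma L2_grad_change_if_L2_state:
  "L2_state t \<Longrightarrow> i \<in> {1..n} \<Longrightarrow> l \<in> {1..m} \<Longrightarrow> L2 (past t) (grad_change t i l)"
  unfolding grad_change_def[abs_def] L2_state_def by (intro L2_diff L2_grad) auto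

lemma L2_estimator_if_L2_state:
  assumes "L2_state t" "i \<in> {1..n}"
  shows "L2 (insert (Index t i) (past t)) (estimator t i)"
proof -
  let ?C = "insert (Index t i) (past t)"
  have C: "?C \<subseteq> draws v n" using assms past_subset by auto
  note up = L2_mono[OF _ subset_insertI C]
  have "L2 ?C (\<lambda>p. grad_change t i (j t i p) p)"
    by (rule L2_select[OF drawn_measurable_known[OF drawn_index[OF assms(2)] insertI1 C] _ C])
      (auto intro!: up L2_grad_change_if_L2_state[OF assms])
  moreover have "L2 ?C (\<lambda>p. (1 / real m) *\<^sub>R (\<Sum>l=1..m. grad (f i l) (w t i l p)))"
    using assms C by (intro L2_scaleR L2_sum L2_grad up) (auto simp: L2_state_def)
  ultimately show ?thesis unfolding estimator_def[abs_def] by (rule L2_add)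
qed

lemma L2_compressed_if_L2_state:
  assumes "L2_state t" "i \<in> {1..n}"
  shows "L2 (insert (Index t i) (past t)) (\<lambda>p. estimator t i p - h t i p)"
proof (rule L2_diff[OF L2_estimator_if_L2_state[OF assms]])
  show "L2 (insert (Index t i) (past t)) (h t i)"
    by (rule L2_mono[of "past t"]) (use assms past_subset in \<open>auto simp: L2_state_def\<close>)
qed

lemma L2_message_if_L2_state:
  assumes "L2_state t" "i \<in> {1..n}"
  shows "L2 (worker_past t i) (message t i)"
  unfolding message_def[abs_def] worker_past_def using assms past_subset
  by (intro L2_quantized[OF quantizer drawn_seed distr_seed _ L2_compressed_if_L2_state]) auto

lemma L2_state: "L2_state t"
proof (induction t)
  case 0
  show ?case
    using past_subset by (simp add: L2_state_def x_0[abs_def] h_0[abs_def] w_0[abs_def] L2_const)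
next
  case (Suc t)
  let ?C = "past (Suc t)"
  have up: "L2 ?C Y" if "L2 (past t) Y" for Y :: "'o \<Rightarrow> 'a"
    by (rule L2_mono[OF that past_mono past_subset]) simp
  have x: "L2 ?C (x t)" and h: "i \<in> {1..n} \<Longrightarrow> L2 ?C (h t i)"
    and w: "i \<in> {1..n} \<Longrightarrow> l \<in> {1..m} \<Longrightarrow> L2 ?C (w t i l)" for i l
    using Suc up by (auto simp: L2_state_def)
  have msg: "L2 ?C (message t i)" if "i \<in> {1..n}" for i
    by (rule L2_mono[OF L2_message_if_L2_state[OF Suc that] worker_past_subset[OF that] past_subset])
  have "L2 ?C (x (Suc t))" unfolding x_Suc[abs_def]
    by (intro L2_diff L2_scaleR L2_sum L2_add x h msg past_subset)
  moreover have "L2 ?C (h (Suc t) i)" if "i \<in> {1..n}" for i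
    unfolding h_Suc[abs_def] by (intro L2_scaleR L2_add h msg that)
  moreover have "L2 ?C (w (Suc t) i l)" if il: "i \<in> {1..n}" "l \<in> {1..m}" for i l
  proof -
    have "Measurable.pred (known ?C) (refreshed t i l)"
    proof (cases v)
      case LSVRG
      have "Coin t \<in> ?C" using Coin_in_draws[OF LSVRG, of t] by (simp add: past_def)
      from drawn_measurable_known[OF drawn_coin[OF LSVRG] this past_subset] LSVRG
      show ?thesis unfolding refreshed_def[abs_def] by simp
    next
      case SAGA
      have "Index t i \<in> ?C" using il by (simp add: past_def)
      from drawn_measurable_known[OF drawn_index[OF il(1)] this past_subset] SAGA
      show ?thesis unfolding refreshed_def[abs_def]
        by (auto intro: measurable_compose)
    qed
    then show ?thesis unfolding w_Suc[abs_def] by (intro L2_if x w il)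
  qed
  ultimately show ?case by (simp add: L2_state_def)
qed

lemma L2_x: "L2 (past t) (x t)"
  and L2_h: "i \<in> {1..n} \<Longrightarrow> L2 (past t) (h t i)"
  and L2_w: "i \<in> {1..n} \<Longrightarrow> l \<in> {1..m} \<Longrightarrow> L2 (past t) (w t i l)"
  using L2_state by (auto simp: L2_state_def)

lemmas L2_grad_change = L2_grad_change_if_L2_state[OF L2_state]
lemmas L2_estimator = L2_estimator_if_L2_state[OF L2_state]
lemmas L2_compressed = L2_compressed_if_L2_state[OF L2_state]
lemmas L2_message = L2_message_if_L2_state[OF L2_state]

lemma L2_noise: "i \<in> {1..n} \<Longrightarrow> L2 (worker_past t i) (noise t i)"
  unfolding noise_def[abs_def]
  by (intro L2_diff L2_add L2_message L2_local_grad; (rule L2_mono[of "past t"])?)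
    (auto intro: L2_x L2_h simp: worker_past_def dest: past_subset[THEN subsetD])

section \<open>Sampling and quantization noise\<close>

lemma estimator_error:
  assumes "i \<in> {1..n}"
  shows "estimator t i p - local_grad i (x t p)
    = grad_change t i (j t i p) p - (1 / real m) *\<^sub>R (\<Sum>l=1..m. grad_change t i l p)"
  unfolding estimator_def local_grad_def grad_change_def sum_subtractf
  by (simp add: scaleR_diff_right)

lemma L2_estimator_error:
  "i \<in> {1..n} \<Longrightarrow> L2 (insert (Index t i) (past t)) (\<lambda>p. estimator t i p - local_grad i (x t p))"
  by (intro L2_diff L2_estimator L2_local_grad L2_mono[OF L2_x])
    (auto dest: past_subset[THEN subsetD])

text \<open>
  The sampled index is independent of \<open>Z\<close> and of all gradient changes. Averaging over it leaves
  the mean deviation from a mean, which is zero.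
\<close>

lemma estimator_error_orthogonal:
  assumes i: "i \<in> {1..n}" and C: "past t \<subseteq> C" "Index t i \<notin> C" and Z: "L2 C Z"
  shows "(\<integral>p. (estimator t i p - local_grad i (x t p)) \<bullet> Z p \<partial>M) = 0"
proof -
  let ?mean = "\<lambda>p. (1 / real m) *\<^sub>R (\<Sum>l=1..m. grad_change t i l p)"
  let ?Y = "\<lambda>l p. (grad_change t i l p - ?mean p) \<bullet> Z p"
  have CD: "C \<subseteq> draws v n" by (rule L2_subset[OF Z])
  have Y: "L2 C (\<lambda>p. grad_change t i l p - ?mean p)" if "l \<in> {1..m}" for l
    using that by (intro L2_diff L2_scaleR L2_sum L2_mono[OF L2_grad_change C(1)] CD i) auto
  have Ym: "?Y l \<in> borel_measurable (known C)" if "l \<in> {1..m}" for l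
    using Y[OF that] Z by (auto simp: L2_def)
  have Yi: "integrable M (?Y l)" if "l \<in> {1..m}" for l
    by (rule integrable_inner[OF Y[OF that] Z])
  have "(\<integral>p. (estimator t i p - local_grad i (x t p)) \<bullet> Z p \<partial>M) = (\<integral>p. ?Y (j t i p) p \<partial>M)"
    by (simp add: estimator_error[OF i])
  also have "\<dots> = (1 / real m) * (\<Sum>l=1..m. \<integral>p. ?Y l p \<partial>M)"
    by (rule expectation_select_drawn(2)[OF drawn_index[OF i] _ prob_index[OF i] Ym Yi CD C(2)]) auto
  also have "(\<Sum>l=1..m. \<integral>p. ?Y l p \<partial>M) = (\<integral>p. (\<Sum>l=1..m. ?Y l p) \<partial>M)"
    using Yi by (intro Bochner_Integration.integral_sum[symmetric]) auto
  also have "(\<lambda>p. \<Sum>l=1..m. ?Y l p) = (\<lambda>p. 0)"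
  proof
    fix p
    have "(\<Sum>l=1..m. ?Y l p) = (\<Sum>l=1..m. grad_change t i l p - ?mean p) \<bullet> Z p"
      by (rule inner_sum_left[symmetric])
    also have "(\<Sum>l=1..m. grad_change t i l p - ?mean p) = 0"
      using m by (simp add: sum_subtractf sum_constant_scaleR del: sum_constant)
    finally show "(\<Sum>l=1..m. ?Y l p) = 0" by simp
  qed
  finally show ?thesis by simp
qed

definition sampling_variance :: "nat \<Rightarrow> nat \<Rightarrow> real" where
  "sampling_variance t i = (1 / real m) * (\<Sum>l=1..m. \<integral>p. (norm (grad_change t i l p))\<^sup>2 \<partial>M)"

lemma expectation_estimator_error_le:
  assumes i: "i \<in> {1..n}"
  shows "(\<integral>p. (norm (estimator t i p - local_grad i (x t p)))\<^sup>2 \<partial>M) \<le> sampling_variance t i"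
proof -
  let ?mean = "\<lambda>p. (1 / real m) *\<^sub>R (\<Sum>l=1..m. grad_change t i l p)"
  let ?Y = "\<lambda>l p. (norm (grad_change t i l p - ?mean p))\<^sup>2"
  have Y: "L2 (past t) (\<lambda>p. grad_change t i l p - ?mean p)" if "l \<in> {1..m}" for l
    using that by (intro L2_diff L2_scaleR L2_sum L2_grad_change i past_subset) auto
  have Ym: "?Y l \<in> borel_measurable (known (past t))" if "l \<in> {1..m}" for l
    using Y[OF that] by (auto simp: L2_def)
  have Yi: "integrable M (?Y l)" if "l \<in> {1..m}" for l
    by (rule L2_integrable[OF Y[OF that]])
  have gi: "integrable M (\<lambda>p. (norm (grad_change t i l p))\<^sup>2)" if "l \<in> {1..m}" for l
    by (rule L2_integrable[OF L2_grad_change[OF i that]])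
  have "(\<integral>p. (norm (estimator t i p - local_grad i (x t p)))\<^sup>2 \<partial>M) = (\<integral>p. ?Y (j t i p) p \<partial>M)"
    by (simp add: estimator_error[OF i])
  also have "\<dots> = (1 / real m) * (\<Sum>l=1..m. \<integral>p. ?Y l p \<partial>M)"
    by (rule expectation_select_drawn(2)[OF drawn_index[OF i] _ prob_index[OF i] Ym Yi past_subset]) auto
  finally have select: "(\<integral>p. (norm (estimator t i p - local_grad i (x t p)))\<^sup>2 \<partial>M)
      = (1 / real m) * (\<Sum>l=1..m. \<integral>p. ?Y l p \<partial>M)" .
  have "(\<Sum>l=1..m. \<integral>p. ?Y l p \<partial>M) = (\<integral>p. (\<Sum>l=1..m. ?Y l p) \<partial>M)"
    using Yi by (intro Bochner_Integration.integral_sum[symmetric]) auto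
  also have "\<dots> \<le> (\<integral>p. (\<Sum>l=1..m. (norm (grad_change t i l p))\<^sup>2) \<partial>M)"
  proof (rule integral_mono)
    show "(\<Sum>l=1..m. ?Y l p) \<le> (\<Sum>l=1..m. (norm (grad_change t i l p))\<^sup>2)" for p
      using sum_norm_minus_mean_le[of "\<lambda>l. grad_change t i l p" "{1..m}"] by simp
  qed (use Yi gi in auto)
  also have "\<dots> = (\<Sum>l=1..m. \<integral>p. (norm (grad_change t i l p))\<^sup>2 \<partial>M)"
    using gi by (intro Bochner_Integration.integral_sum) auto
  finally show ?thesis
    unfolding select sampling_variance_def by (intro mult_left_mono) auto
qed

lemma noise_split: "noise t i p = (message t i p - (estimator t i p - h t i p))
    + (estimator t i p - local_grad i (x t p))"
  by (simp add: noise_def)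

lemma L2_quantization_error:
  assumes i: "i \<in> {1..n}"
  shows "L2 (worker_past t i) (\<lambda>p. message t i p - (estimator t i p - h t i p))"
proof (rule L2_diff[OF L2_message[OF i] L2_mono[OF L2_compressed[OF i]]])
  show "worker_past t i \<subseteq> draws v n" using worker_past_subset[OF i] past_subset by blast
qed (auto simp: worker_past_def)

text \<open>
  Only the seed is excluded from the test vector; it may depend on the index that worker \<open>i\<close>
  samples in the same round, hence on the quantized vector itself.
\<close>

lemma quantization_error_orthogonal:
  assumes i: "i \<in> {1..n}" and C: "past t \<subseteq> C" "Seed t i \<notin> C" and Z: "L2 C Z"
  shows "(\<integral>p. (message t i p - (estimator t i p - h t i p)) \<bullet> Z p \<partial>M) = 0"
proof -
  let ?C = "insert (Index t i) C"
  have CD: "?C \<subseteq> draws v n" using L2_subset[OF Z] i by auto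
  have Z': "L2 ?C Z" by (rule L2_mono[OF Z _ CD]) auto
  have Y: "L2 ?C (\<lambda>p. estimator t i p - h t i p)"
    by (rule L2_mono[OF L2_compressed[OF i] _ CD]) (use C in auto)
  have "(\<integral>p. message t i p \<bullet> Z p \<partial>M) = (\<integral>p. (estimator t i p - h t i p) \<bullet> Z p \<partial>M)"
    unfolding message_def using C
    by (intro expectation_inner_quantized[OF quantizer drawn_seed[OF i] distr_seed[OF i] _ Y Z']) auto
  then show ?thesis
    using integrable_inner[OF L2_message[OF i] Z] integrable_inner[OF Y Z]
    by (simp add: inner_diff_left[of "message t i _"])
qed

text \<open>
  The draws of worker \<open>i\<close> in round \<open>t\<close> are all that its noise adds to the past. The test vector may
  depend on any others, in particular on the noise of another worker in the same round.
\<close>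

lemma noise_orthogonal:
  assumes i: "i \<in> {1..n}" and C: "past t \<subseteq> C" "Index t i \<notin> C" "Seed t i \<notin> C" and Z: "L2 C Z"
  shows "(\<integral>p. noise t i p \<bullet> Z p \<partial>M) = 0"
proof -
  note e = L2_quantization_error[OF i]
  show ?thesis
    unfolding noise_split inner_add_left
    using integrable_inner[OF e Z] integrable_inner[OF L2_estimator_error[OF i] Z]
      quantization_error_orthogonal[OF i C(1,3) Z] estimator_error_orthogonal[OF i C(1,2) Z]
    by (subst Bochner_Integration.integral_add) auto
qed

text \<open>
  The noise splits into quantization error and sampling error, and the quantization error is
  orthogonal to both the sampling error and the quantized vector. The second fact turns the
  second-moment bound of the quantizer into the variance bound with \<open>\<omega>\<close> in place of \<open>\<omega> + 1\<close>.
  The quantized vector, in turn, is the sampling error plus a vector fixed by the past, and these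
  are again orthogonal.
\<close>

lemma expectation_noise_le:
  assumes i: "i \<in> {1..n}"
  shows "(\<integral>p. (norm (noise t i p))\<^sup>2 \<partial>M) \<le> (\<omega> + 1) * sampling_variance t i
    + \<omega> * (\<integral>p. (norm (local_grad i (x t p) - h t i p))\<^sup>2 \<partial>M)"
proof -
  let ?C = "insert (Index t i) (past t)"
  let ?e = "\<lambda>p. message t i p - (estimator t i p - h t i p)"
  let ?r = "\<lambda>p. estimator t i p - local_grad i (x t p)"
  let ?d = "\<lambda>p. local_grad i (x t p) - h t i p"
  let ?E = "\<lambda>Y. \<integral>p. (norm (Y p :: 'a))\<^sup>2 \<partial>M"
  have y: "L2 ?C (\<lambda>p. estimator t i p - h t i p)" by (rule L2_compressed[OF i])
  have e: "L2 (worker_past t i) ?e" by (rule L2_quantization_error[OF i])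
  have r: "L2 ?C ?r" by (rule L2_estimator_error[OF i])
  have d: "L2 (past t) ?d" by (intro L2_diff L2_local_grad L2_x L2_h i)
  have ey: "(\<integral>p. ?e p \<bullet> (estimator t i p - h t i p) \<partial>M) = 0"
    by (rule quantization_error_orthogonal[OF i _ _ y]) auto
  have er: "(\<integral>p. ?e p \<bullet> ?r p \<partial>M) = 0"
    by (rule quantization_error_orthogonal[OF i _ _ r]) auto
  have rd: "(\<integral>p. ?r p \<bullet> ?d p \<partial>M) = 0"
    by (rule estimator_error_orthogonal[OF i _ _ d]) auto
  have noise: "?E (noise t i) = ?E ?e + ?E ?r"
    unfolding noise_split by (rule expectation_norm_add[OF e r er])
  have compressed: "?E (\<lambda>p. estimator t i p - h t i p) = ?E ?r + ?E ?d"
    using expectation_norm_add[OF r d rd] by simp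
  have "?E (message t i) = ?E ?e + ?E (\<lambda>p. estimator t i p - h t i p)"
    using expectation_norm_add[OF e y ey] by simp
  moreover have "?E (message t i) \<le> (\<omega> + 1) * ?E (\<lambda>p. estimator t i p - h t i p)"
    unfolding message_def
    by (rule expectation_norm_quantized(2)[OF quantizer drawn_seed[OF i] distr_seed[OF i] _ y]) auto
  ultimately have "?E ?e \<le> \<omega> * (?E ?r + ?E ?d)"
    unfolding compressed by (simp add: algebra_simps)
  then have "?E (noise t i) \<le> (\<omega> + 1) * ?E ?r + \<omega> * ?E ?d"
    unfolding noise by (simp add: algebra_simps)
  also have "\<dots> \<le> (\<omega> + 1) * sampling_variance t i + \<omega> * ?E ?d"
    using \<omega> by (intro add_right_mono mult_left_mono expectation_estimator_error_le i) auto
  finally show ?thesis .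
qed

section \<open>One round of the algorithm\<close>

definition distance :: "nat \<Rightarrow> real" where
  "distance t = (\<integral>p. (norm (x t p - xs))\<^sup>2 \<partial>M)"

definition shift_error :: "nat \<Rightarrow> real" where
  "shift_error t = (\<Sum>i=1..n. \<integral>p. (norm (h t i p - local_grad i xs))\<^sup>2 \<partial>M)"

definition ref_error :: "nat \<Rightarrow> real" where
  "ref_error t = (\<Sum>i=1..n. \<Sum>l=1..m. \<integral>p. deviation i l (w t i l p) \<partial>M)"

definition expected_gap :: "nat \<Rightarrow> real" where
  "expected_gap t = (\<integral>p. gap (x t p) \<partial>M)"

lemma L2_deviation:
  assumes "i \<in> {1..n}" "l \<in> {1..m}" "L2 C Y"
  shows "L2 C (\<lambda>p. grad (f i l) (Y p) - grad (f i l) xs)"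
  by (intro L2_diff L2_grad L2_const assms L2_subset[OF assms(3)])

lemma deviation_measurable_known:
  assumes "i \<in> {1..n}" "l \<in> {1..m}" "L2 C Y"
  shows "(\<lambda>p. deviation i l (Y p)) \<in> borel_measurable (known C)"
  unfolding deviation_def using L2_measurable_known[OF L2_deviation[OF assms]] by measurable

lemma integrable_deviation:
  assumes "i \<in> {1..n}" "l \<in> {1..m}" "L2 C Y"
  shows "integrable M (\<lambda>p. deviation i l (Y p))"
  unfolding deviation_def by (rule L2_integrable[OF L2_deviation[OF assms]])

lemma gap_measurable_known: "(\<lambda>p. gap (x t p)) \<in> borel_measurable (known (past t))"
  by (rule measurable_compose[OF L2_measurable_known[OF L2_x]
        borel_measurable_continuous_onI[OF continuous_on_gap]])

lemma integrable_gap: "integrable M (\<lambda>p. gap (x t p))"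
proof (rule Bochner_Integration.integrable_bound)
  show "integrable M (\<lambda>p. L / 2 * (norm (x t p - xs))\<^sup>2)"
    by (intro integrable_mult_right L2_integrable[where C="past t"] L2_diff L2_x L2_const past_subset)
  show "(\<lambda>p. gap (x t p)) \<in> borel_measurable M"
    by (rule measurable_known[OF gap_measurable_known past_subset])
  show "AE p in M. norm (gap (x t p)) \<le> norm (L / 2 * (norm (x t p - xs))\<^sup>2)"
    using L gap_nonneg gap_le_quadratic by (intro AE_I2) simp
qed

lemma expected_gap_nonneg: "0 \<le> expected_gap t"
  unfolding expected_gap_def by (simp add: gap_nonneg)

lemma expected_deviation_le:
  "(\<Sum>i=1..n. \<Sum>l=1..m. \<integral>p. deviation i l (x t p) \<partial>M) \<le> 2 * L * real n * real m * expected_gap t"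
proof -
  have int: "integrable M (\<lambda>p. deviation i l (x t p))" if "i \<in> {1..n}" "l \<in> {1..m}" for i l
    by (rule integrable_deviation[OF that L2_x])
  have "(\<Sum>i=1..n. \<Sum>l=1..m. \<integral>p. deviation i l (x t p) \<partial>M)
      = (\<integral>p. (\<Sum>i=1..n. \<Sum>l=1..m. deviation i l (x t p)) \<partial>M)"
    by (rule has_bochner_integral_integral_eq[symmetric],
        intro has_bochner_integral_sum has_bochner_integral_integrable int)
  also have "\<dots> \<le> (\<integral>p. 2 * L * real n * real m * gap (x t p) \<partial>M)"
    by (intro integral_mono sum_deviation_le integrable_mult_right integrable_gap
        Bochner_Integration.integrable_sum int)
  finally show ?thesis by (simp add: expected_gap_def)
qed

text \<open>
  The variance is reduced: as iterates and reference points approach \<open>xs\<close>, both terms of the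
  bound vanish.
\<close>

lemma sum_sampling_variance_le:
  "(\<Sum>i=1..n. sampling_variance t i) \<le> 4 * L * real n * expected_gap t + 2 / real m * ref_error t"
proof -
  have "(\<integral>p. (norm (grad_change t i l p))\<^sup>2 \<partial>M)
      \<le> 2 * (\<integral>p. deviation i l (x t p) \<partial>M) + 2 * (\<integral>p. deviation i l (w t i l p) \<partial>M)"
    if il: "i \<in> {1..n}" "l \<in> {1..m}" for i l
  proof -
    have "(norm (grad_change t i l p))\<^sup>2 \<le> 2 * deviation i l (x t p) + 2 * deviation i l (w t i l p)" for p
      using norm_add_power2_le[of "grad (f i l) (x t p) - grad (f i l) xs"
          "grad (f i l) xs - grad (f i l) (w t i l p)"]
      by (simp add: grad_change_def deviation_def norm_minus_commute[of "grad (f i l) xs"])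
    then have "(\<integral>p. (norm (grad_change t i l p))\<^sup>2 \<partial>M)
        \<le> (\<integral>p. 2 * deviation i l (x t p) + 2 * deviation i l (w t i l p) \<partial>M)"
      by (intro integral_mono L2_integrable[OF L2_grad_change[OF il]] Bochner_Integration.integrable_add
          integrable_mult_right integrable_deviation[OF il L2_x] integrable_deviation[OF il L2_w[OF il]])
    then show ?thesis
      using integrable_deviation[OF il L2_x] integrable_deviation[OF il L2_w[OF il]] by simp
  qed
  then have "(\<Sum>i=1..n. sampling_variance t i) \<le> (\<Sum>i=1..n. (1 / real m) * (\<Sum>l=1..m.
      2 * (\<integral>p. deviation i l (x t p) \<partial>M) + 2 * (\<integral>p. deviation i l (w t i l p) \<partial>M)))"
    unfolding sampling_variance_def by (intro sum_mono mult_left_mono) auto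
  also have "\<dots> = 2 / real m * (\<Sum>i=1..n. \<Sum>l=1..m. \<integral>p. deviation i l (x t p) \<partial>M)
      + 2 / real m * ref_error t"
    by (simp add: ref_error_def sum.distrib sum_distrib_left[symmetric] add_divide_distrib
        sum_divide_distrib[symmetric])
  also have "\<dots> \<le> 2 / real m * (2 * L * real n * real m * expected_gap t) + 2 / real m * ref_error t"
    by (intro add_right_mono mult_left_mono expected_deviation_le) auto
  finally show ?thesis using m by simp
qed

definition grad_error :: "nat \<Rightarrow> real" where
  "grad_error t = (\<Sum>i=1..n. \<integral>p. (norm (local_grad i (x t p) - local_grad i xs))\<^sup>2 \<partial>M)"

definition shift_gap :: "nat \<Rightarrow> real" where
  "shift_gap t = (\<Sum>i=1..n. \<integral>p. (norm (local_grad i (x t p) - h t i p))\<^sup>2 \<partial>M)"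

lemma L2_grad_error: "i \<in> {1..n} \<Longrightarrow> L2 (past t) (\<lambda>p. local_grad i (x t p) - local_grad i xs)"
  by (intro L2_diff L2_local_grad L2_x L2_const past_subset)

lemma L2_shift_error: "i \<in> {1..n} \<Longrightarrow> L2 (past t) (\<lambda>p. h t i p - local_grad i xs)"
  by (intro L2_diff L2_h L2_const past_subset)

lemma L2_shift_gap: "i \<in> {1..n} \<Longrightarrow> L2 (past t) (\<lambda>p. local_grad i (x t p) - h t i p)"
  by (intro L2_diff L2_local_grad L2_x L2_h)

lemma grad_error_le: "grad_error t \<le> 2 * L * real n * expected_gap t"
proof -
  have "(\<integral>p. (norm (local_grad i (x t p) - local_grad i xs))\<^sup>2 \<partial>M)
      \<le> (1 / real m) * (\<Sum>l=1..m. \<integral>p. deviation i l (x t p) \<partial>M)" if i: "i \<in> {1..n}" for i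
  proof -
    have int: "integrable M (\<lambda>p. deviation i l (x t p))" if "l \<in> {1..m}" for l
      by (rule integrable_deviation[OF i that L2_x])
    have "(\<integral>p. (norm (local_grad i (x t p) - local_grad i xs))\<^sup>2 \<partial>M)
        \<le> (\<integral>p. (1 / real m) * (\<Sum>l=1..m. deviation i l (x t p)) \<partial>M)"
      using int by (intro integral_mono norm_local_grad_diff L2_integrable[OF L2_grad_error[OF i]]
          integrable_mult_right) auto
    also have "\<dots> = (1 / real m) * (\<Sum>l=1..m. \<integral>p. deviation i l (x t p) \<partial>M)"
      using int by (simp add: Bochner_Integration.integral_sum del: One_nat_def)
    finally show ?thesis .
  qed
  then have "grad_error t \<le> (\<Sum>i=1..n. (1 / real m) * (\<Sum>l=1..m. \<integral>p. deviation i l (x t p) \<partial>M))"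
    unfolding grad_error_def by (intro sum_mono) auto
  also have "\<dots> = (1 / real m) * (\<Sum>i=1..n. \<Sum>l=1..m. \<integral>p. deviation i l (x t p) \<partial>M)"
    by (simp add: sum_distrib_left)
  also have "\<dots> \<le> (1 / real m) * (2 * L * real n * real m * expected_gap t)"
    by (intro mult_left_mono expected_deviation_le) auto
  finally show ?thesis using m by simp
qed

lemma shift_gap_nonneg: "0 \<le> shift_gap t"
  unfolding shift_gap_def by (intro sum_nonneg) simp

lemma shift_gap_le: "shift_gap t \<le> 2 * grad_error t + 2 * shift_error t"
proof -
  have "(\<integral>p. (norm (local_grad i (x t p) - h t i p))\<^sup>2 \<partial>M)
      \<le> 2 * (\<integral>p. (norm (local_grad i (x t p) - local_grad i xs))\<^sup>2 \<partial>M)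
        + 2 * (\<integral>p. (norm (h t i p - local_grad i xs))\<^sup>2 \<partial>M)" if i: "i \<in> {1..n}" for i
  proof -
    note int = L2_integrable[OF L2_grad_error[OF i, of t]] L2_integrable[OF L2_shift_error[OF i, of t]]
    have "(norm (local_grad i (x t p) - h t i p))\<^sup>2
        \<le> 2 * (norm (local_grad i (x t p) - local_grad i xs))\<^sup>2
          + 2 * (norm (h t i p - local_grad i xs))\<^sup>2" for p
      using norm_add_power2_le[of "local_grad i (x t p) - local_grad i xs" "local_grad i xs - h t i p"]
      by (simp add: norm_minus_commute[of "local_grad i xs"])
    then have "(\<integral>p. (norm (local_grad i (x t p) - h t i p))\<^sup>2 \<partial>M)
      \<le> (\<integral>p. 2 * (norm (local_grad i (x t p) - local_grad i xs))\<^sup>2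
          + 2 * (norm (h t i p - local_grad i xs))\<^sup>2 \<partial>M)"
      using int by (intro integral_mono L2_integrable[OF L2_shift_gap[OF i]]) auto
    then show ?thesis using int by simp
  qed
  then have "shift_gap t \<le> (\<Sum>i=1..n. 2 * (\<integral>p. (norm (local_grad i (x t p) - local_grad i xs))\<^sup>2 \<partial>M)
        + 2 * (\<integral>p. (norm (h t i p - local_grad i xs))\<^sup>2 \<partial>M))"
    unfolding shift_gap_def by (intro sum_mono) auto
  then show ?thesis
    by (simp add: grad_error_def shift_error_def sum.distrib sum_distrib_left)
qed

lemma sum_noise_le:
  "(\<Sum>i=1..n. \<integral>p. (norm (noise t i p))\<^sup>2 \<partial>M)
    \<le> (\<omega> + 1) * (\<Sum>i=1..n. sampling_variance t i) + \<omega> * shift_gap t"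
proof -
  have "(\<Sum>i=1..n. \<integral>p. (norm (noise t i p))\<^sup>2 \<partial>M) \<le> (\<Sum>i=1..n. (\<omega> + 1) * sampling_variance t i
      + \<omega> * (\<integral>p. (norm (local_grad i (x t p) - h t i p))\<^sup>2 \<partial>M))"
    by (intro sum_mono expectation_noise_le)
  then show ?thesis by (simp add: shift_gap_def sum.distrib sum_distrib_left)
qed

text \<open>
  The new iterate is an exact gradient step from the past iterate plus averaged noise. The noise is
  orthogonal to the past and across workers, so its second moment carries the factor
  \<open>1 / n\<^sup>2\<close> with a plain sum over workers.
\<close>

lemma distance_Suc_le:
  "distance (Suc t) \<le> distance t - 2 * \<gamma> * expected_gap t + \<gamma>\<^sup>2 * (2 * L * expected_gap t
    + ((\<omega> + 1) * (\<Sum>i=1..n. sampling_variance t i) + \<omega> * shift_gap t) / (real n)\<^sup>2)"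
proof -
  let ?D = "past (Suc t)"
  let ?z = "\<lambda>p. x t p - xs - \<gamma> *\<^sub>R global_grad (x t p)"
  let ?e = "\<lambda>p. \<Sum>i=1..n. noise t i p"
  have noise: "L2 ?D (noise t i)" if "i \<in> {1..n}" for i
    by (rule L2_mono[OF L2_noise[OF that] worker_past_subset[OF that] past_subset])
  have e: "L2 ?D ?e" by (intro L2_sum noise past_subset)
  have z: "L2 (past t) ?z"
    by (intro L2_diff L2_scaleR L2_global_grad L2_x L2_const past_subset)
  have step: "x (Suc t) p - xs = ?z p + (- (\<gamma> / real n)) *\<^sub>R ?e p" for p
    by (simp add: x_Suc noise_def global_grad_def sum_subtractf scaleR_diff_right algebra_simps)
  have "(\<integral>p. noise t i p \<bullet> ?z p \<partial>M) = 0" if "i \<in> {1..n}" for i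
    by (rule noise_orthogonal[OF that _ _ _ z]) auto
  moreover have "(\<integral>p. ?z p \<bullet> ?e p \<partial>M) = (\<Sum>i=1..n. \<integral>p. ?z p \<bullet> noise t i p \<partial>M)"
    by (rule expectation_inner_sum_right[OF z noise])
  ultimately have ze: "(\<integral>p. ?z p \<bullet> ?e p \<partial>M) = 0"
    by (simp add: inner_commute[of "?z _"])
  have "(\<integral>p. ?z p \<bullet> ((- (\<gamma> / real n)) *\<^sub>R ?e p) \<partial>M) = - (\<gamma> / real n) * (\<integral>p. ?z p \<bullet> ?e p \<partial>M)"
    by (simp only: inner_scaleR_right integral_mult_right_zero)
  then have orth: "(\<integral>p. ?z p \<bullet> ((- (\<gamma> / real n)) *\<^sub>R ?e p) \<partial>M) = 0" using ze by simp
  have "distance (Suc t) = (\<integral>p. (norm (?z p))\<^sup>2 \<partial>M)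
      + (\<integral>p. (norm ((- (\<gamma> / real n)) *\<^sub>R ?e p))\<^sup>2 \<partial>M)"
    unfolding distance_def step by (rule expectation_norm_add[OF z L2_scaleR[OF e] orth])
  moreover have "(\<integral>p. (norm ((- (\<gamma> / real n)) *\<^sub>R ?e p))\<^sup>2 \<partial>M) = (\<gamma> / real n)\<^sup>2 * (\<integral>p. (norm (?e p))\<^sup>2 \<partial>M)"
    unfolding norm_scaleR power_mult_distrib by (simp add: power_divide)
  moreover have "(\<integral>p. (norm (?e p))\<^sup>2 \<partial>M) = (\<Sum>i=1..n. \<integral>p. (norm (noise t i p))\<^sup>2 \<partial>M)"
  proof (rule expectation_norm_sum_orthogonal[OF _ past_subset noise])
    fix i l assume il: "i \<in> {1..n}" "l \<in> {1..n}" "i \<noteq> l"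
    show "(\<integral>p. noise t i p \<bullet> noise t l p \<partial>M) = 0"
      by (rule noise_orthogonal[OF il(1) _ _ _ L2_noise[OF il(2)]])
        (use il in \<open>auto simp: worker_past_def\<close>)
  qed auto
  ultimately have split: "distance (Suc t) = (\<integral>p. (norm (?z p))\<^sup>2 \<partial>M)
      + (\<gamma> / real n)\<^sup>2 * (\<Sum>i=1..n. \<integral>p. (norm (noise t i p))\<^sup>2 \<partial>M)" by simp
  have "(\<integral>p. (norm (?z p))\<^sup>2 \<partial>M)
      \<le> (\<integral>p. (norm (x t p - xs))\<^sup>2 + (2 * L * \<gamma>\<^sup>2 - 2 * \<gamma>) * gap (x t p) \<partial>M)"
  proof (rule integral_mono)
    show "(norm (?z p))\<^sup>2 \<le> (norm (x t p - xs))\<^sup>2 + (2 * L * \<gamma>\<^sup>2 - 2 * \<gamma>) * gap (x t p)" for p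
    proof -
      have "(norm (?z p))\<^sup>2 = (norm (x t p - xs))\<^sup>2 - 2 * \<gamma> * (global_grad (x t p) \<bullet> (x t p - xs))
          + \<gamma>\<^sup>2 * (norm (global_grad (x t p)))\<^sup>2"
        unfolding power2_norm_eq_inner
        by (simp add: inner_diff_left inner_diff_right inner_commute power2_eq_square algebra_simps)
      also have "\<dots> \<le> (norm (x t p - xs))\<^sup>2 - 2 * \<gamma> * gap (x t p) + \<gamma>\<^sup>2 * (2 * L * gap (x t p))"
        using \<gamma> by (intro add_mono diff_mono mult_left_mono gap_le_inner_grad norm_global_grad) auto
      finally show ?thesis by (simp add: algebra_simps)
    qed
    show "integrable M (\<lambda>p. (norm (x t p - xs))\<^sup>2 + (2 * L * \<gamma>\<^sup>2 - 2 * \<gamma>) * gap (x t p))"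
      by (intro Bochner_Integration.integrable_add integrable_mult_right integrable_gap
          L2_integrable[where C="past t"] L2_diff L2_x L2_const past_subset)
  qed (rule L2_integrable[OF z])
  also have "\<dots> = distance t + (2 * L * \<gamma>\<^sup>2 - 2 * \<gamma>) * expected_gap t"
    unfolding distance_def expected_gap_def
    by (subst Bochner_Integration.integral_add)
      (auto intro!: integrable_gap L2_integrable[where C="past t"] L2_diff L2_x L2_const past_subset)
  finally have "distance (Suc t) \<le> distance t + (2 * L * \<gamma>\<^sup>2 - 2 * \<gamma>) * expected_gap t
      + (\<gamma> / real n)\<^sup>2 * (\<Sum>i=1..n. \<integral>p. (norm (noise t i p))\<^sup>2 \<partial>M)"
    unfolding split by (rule add_right_mono)
  also have "\<dots> \<le> distance t + (2 * L * \<gamma>\<^sup>2 - 2 * \<gamma>) * expected_gap t + (\<gamma> / real n)\<^sup>2 *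
      ((\<omega> + 1) * (\<Sum>i=1..n. sampling_variance t i) + \<omega> * shift_gap t)"
    by (intro add_left_mono mult_left_mono sum_noise_le) auto
  finally show ?thesis by (simp add: algebra_simps power_divide add_divide_distrib)
qed

text \<open>
  Each shift moves a fraction \<open>\<alpha>\<close> towards the current local gradient, up to noise. The condition
  \<open>\<alpha> * (\<omega> + 1) \<le> 1\<close> is exactly what lets the gain \<open>\<alpha> * (1 - \<alpha>)\<close> of the convex combination
  absorb the quantization noise \<open>\<alpha>\<^sup>2 * \<omega>\<close> and turns \<open>\<alpha>\<^sup>2 * (\<omega> + 1)\<close> into \<open>\<alpha>\<close> in front
  of the sampling variance.
\<close>

lemma shift_error_Suc_le:
  "shift_error (Suc t) \<le> (1 - \<alpha>) * shift_error t
    + \<alpha> * grad_error t + \<alpha> * (\<Sum>i=1..n. sampling_variance t i)"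
proof -
  have step: "(\<integral>p. (norm (h (Suc t) i p - local_grad i xs))\<^sup>2 \<partial>M)
      = (1 - \<alpha>) * (\<integral>p. (norm (h t i p - local_grad i xs))\<^sup>2 \<partial>M)
        + \<alpha> * (\<integral>p. (norm (local_grad i (x t p) - local_grad i xs))\<^sup>2 \<partial>M)
        - \<alpha> * (1 - \<alpha>) * (\<integral>p. (norm (local_grad i (x t p) - h t i p))\<^sup>2 \<partial>M)
        + \<alpha>\<^sup>2 * (\<integral>p. (norm (noise t i p))\<^sup>2 \<partial>M)" if i: "i \<in> {1..n}" for i
  proof -
    let ?a = "\<lambda>p. h t i p - local_grad i xs"
    let ?b = "\<lambda>p. local_grad i (x t p) - local_grad i xs"
    let ?z = "\<lambda>p. ?a p + \<alpha> *\<^sub>R (?b p - ?a p)"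
    note a = L2_shift_error[OF i, of t] and b = L2_grad_error[OF i, of t]
    note int = L2_integrable[OF a] L2_integrable[OF b] L2_integrable[OF L2_shift_gap[OF i, of t]]
    have z: "L2 (past t) ?z" by (intro L2_add L2_scaleR L2_diff[OF b a] a)
    have "(\<integral>p. noise t i p \<bullet> ?z p \<partial>M) = 0"
      by (rule noise_orthogonal[OF i _ _ _ z]) auto
    then have orth: "(\<integral>p. ?z p \<bullet> (\<alpha> *\<^sub>R noise t i p) \<partial>M) = 0"
      unfolding inner_scaleR_right inner_commute[of "?z _"] by simp
    have "h (Suc t) i p - local_grad i xs = ?z p + \<alpha> *\<^sub>R noise t i p" for p
      by (simp add: h_Suc noise_def algebra_simps)
    then have "(\<integral>p. (norm (h (Suc t) i p - local_grad i xs))\<^sup>2 \<partial>M)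
        = (\<integral>p. (norm (?z p))\<^sup>2 \<partial>M) + (\<integral>p. (norm (\<alpha> *\<^sub>R noise t i p))\<^sup>2 \<partial>M)"
      by (simp only: expectation_norm_add[OF z L2_scaleR[OF L2_noise[OF i]] orth])
    also have "(\<integral>p. (norm (\<alpha> *\<^sub>R noise t i p))\<^sup>2 \<partial>M) = \<alpha>\<^sup>2 * (\<integral>p. (norm (noise t i p))\<^sup>2 \<partial>M)"
      by (simp add: power_mult_distrib)
    also have "(\<integral>p. (norm (?z p))\<^sup>2 \<partial>M) = (1 - \<alpha>) * (\<integral>p. (norm (?a p))\<^sup>2 \<partial>M)
        + \<alpha> * (\<integral>p. (norm (?b p))\<^sup>2 \<partial>M)
        - \<alpha> * (1 - \<alpha>) * (\<integral>p. (norm (local_grad i (x t p) - h t i p))\<^sup>2 \<partial>M)"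
      unfolding norm_convex_combination using int by simp
    finally show ?thesis .
  qed
  have "\<alpha> * (\<omega> + 1) \<le> 1" using \<alpha> \<omega> by (simp add: field_simps)
  then have contract: "\<alpha>\<^sup>2 * (\<omega> + 1) \<le> \<alpha>" "\<alpha>\<^sup>2 * \<omega> \<le> \<alpha> * (1 - \<alpha>)"
    using mult_left_mono[of "\<alpha> * (\<omega> + 1)" 1 \<alpha>] \<alpha>(1) by (auto simp: power2_eq_square algebra_simps)
  have sv: "0 \<le> (\<Sum>i=1..n. sampling_variance t i)"
    unfolding sampling_variance_def by (intro sum_nonneg mult_nonneg_nonneg) auto
  have "shift_error (Suc t) = (1 - \<alpha>) * shift_error t + \<alpha> * grad_error t
      - \<alpha> * (1 - \<alpha>) * shift_gap t + \<alpha>\<^sup>2 * (\<Sum>i=1..n. \<integral>p. (norm (noise t i p))\<^sup>2 \<partial>M)"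
    unfolding shift_error_def[of "Suc t"] using step
    by (simp add: shift_error_def grad_error_def shift_gap_def sum.distrib sum_subtractf sum_distrib_left)
  also have "\<dots> \<le> (1 - \<alpha>) * shift_error t + \<alpha> * grad_error t - \<alpha> * (1 - \<alpha>) * shift_gap t
      + \<alpha>\<^sup>2 * ((\<omega> + 1) * (\<Sum>i=1..n. sampling_variance t i) + \<omega> * shift_gap t)"
    by (intro add_left_mono mult_left_mono sum_noise_le) auto
  also have "\<dots> \<le> (1 - \<alpha>) * shift_error t + \<alpha> * grad_error t + \<alpha> * (\<Sum>i=1..n. sampling_variance t i)"
    using mult_right_mono[OF contract(1) sv] mult_right_mono[OF contract(2) shift_gap_nonneg[of t]]
    by (simp add: algebra_simps)
  finally show ?thesis .
qed

text \<open>
  The only place where the two variants differ. In both, a reference point is replaced with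
  probability \<open>1 / m\<close>, by a coin common to all workers or by the worker's own index, and by
  linearity only this probability enters.
\<close>

lemma expectation_deviation_Suc:
  assumes il: "i \<in> {1..n}" "l \<in> {1..m}"
  shows "(\<integral>p. deviation i l (w (Suc t) i l p) \<partial>M)
    = (1 / real m) * (\<integral>p. deviation i l (x t p) \<partial>M)
      + (1 - 1 / real m) * (\<integral>p. deviation i l (w t i l p) \<partial>M)"
proof -
  note dx = deviation_measurable_known[OF il L2_x, of t] integrable_deviation[OF il L2_x, of t]
  note dw = deviation_measurable_known[OF il L2_w[OF il], of t] integrable_deviation[OF il L2_w[OF il], of t]
  have "deviation i l (w (Suc t) i l p)
      = (if refreshed t i l p then deviation i l (x t p) else deviation i l (w t i l p))" for p
    by (simp add: w_Suc)
  moreover have "(\<integral>p. (if refreshed t i l p then deviation i l (x t p) else deviation i l (w t i l p)) \<partial>M)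
    = (1 / real m) * (\<integral>p. deviation i l (x t p) \<partial>M)
      + (1 - 1 / real m) * (\<integral>p. deviation i l (w t i l p) \<partial>M)"
  proof (cases v)
    case LSVRG
    show ?thesis
      using expectation_if_drawn[OF drawn_coin[OF LSVRG] _ prob_coin[OF LSVRG] dx dw past_subset
          not_in_past(1)]
      unfolding refreshed_def using LSVRG by simp
  next
    case SAGA
    show ?thesis
      using expectation_if_drawn[OF drawn_index[OF il(1)] _ prob_index[OF il] dx dw past_subset
          not_in_past(2)]
      unfolding refreshed_def using SAGA by simp
  qed
  ultimately show ?thesis by simp
qed

lemma ref_error_Suc_le:
  "ref_error (Suc t) \<le> (1 - 1 / real m) * ref_error t + 2 * L * real n * expected_gap t"
proof -
  have "ref_error (Suc t) = (1 / real m) * (\<Sum>i=1..n. \<Sum>l=1..m. \<integral>p. deviation i l (x t p) \<partial>M)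
      + (1 - 1 / real m) * ref_error t"
    unfolding ref_error_def sum_distrib_left sum.distrib[symmetric]
    by (intro sum.cong expectation_deviation_Suc) auto
  also have "\<dots> \<le> (1 / real m) * (2 * L * real n * real m * expected_gap t)
      + (1 - 1 / real m) * ref_error t"
    by (intro add_right_mono mult_left_mono expected_deviation_le) auto
  finally show ?thesis using m by simp
qed

section \<open>Descent of the potential\<close>

definition potential :: "nat \<Rightarrow> real" where
  "potential t = distance t
     + 4 * (\<omega> + 1) / (\<alpha> * (real n)\<^sup>2) * \<gamma>\<^sup>2 * shift_error t
     + 16 * (\<omega> + 1) / (real n)\<^sup>2 * \<gamma>\<^sup>2 * ref_error t"

lemma potential_0:
  "potential 0 = initial_potential n m f \<gamma>
     (4 * (\<omega> + 1) / (\<alpha> * (real n)\<^sup>2)) (16 * (\<omega> + 1) / (real n)\<^sup>2) xs x0 h0 w0"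
  by (simp add: potential_def initial_potential_def distance_def shift_error_def ref_error_def
      deviation_def x_0 h_0 w_0 grad_local_obj prob_space)

lemma potential_nonneg: "0 \<le> potential t"
proof -
  have "0 \<le> distance t" "0 \<le> shift_error t" "0 \<le> ref_error t"
    unfolding distance_def shift_error_def ref_error_def deviation_def
    by (auto intro!: sum_nonneg)
  then show ?thesis using \<omega> \<alpha> unfolding potential_def by (intro add_nonneg_nonneg mult_nonneg_nonneg) auto
qed

text \<open>
  With \<open>\<rho> = (\<omega> + 1) / n\<^sup>2\<close>, \<open>G = L * n * expected_gap\<close> and \<open>W = ref_error / m\<close>, the three
  recursions add at most the following multiples of \<open>\<gamma>\<^sup>2 * \<rho>\<close>, apart from the terms
  \<open>- 2 * \<gamma> * expected_gap + 2 * L * \<gamma>\<^sup>2 * expected_gap\<close> of the exact gradient step: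
  \<^item> the distance: \<open>8 * G + 2 * W + 2 * shift_error\<close>;
  \<^item> the shifts: \<open>24 * G + 8 * W - 4 * shift_error\<close>;
  \<^item> the reference points: \<open>32 * G - 16 * W\<close>.
  
  The two weights of the potential make the coefficients of \<open>W\<close> and of the shift error negative
  in the sum. What remains of \<open>G\<close> is \<open>64 * G\<close>, below the \<open>72 * G\<close> that the constant \<open>36\<close>
  stands for.
\<close>

lemma potential_Suc_le:
  "potential (Suc t) \<le> potential t
     - 2 * (\<gamma> - L * \<gamma>\<^sup>2 * (1 + 36 * (\<omega> + 1) / real n)) * expected_gap t"
proof -
  define \<rho> where "\<rho> = (\<omega> + 1) / (real n)\<^sup>2"
  define G where "G = L * real n * expected_gap t"
  define W where "W = ref_error t / real m"
  have \<rho>: "0 \<le> \<rho>" using \<omega> by (simp add: \<rho>_def)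
  have G: "0 \<le> G" using L expected_gap_nonneg[of t] by (simp add: G_def)
  have W: "0 \<le> W" unfolding W_def ref_error_def deviation_def by (auto intro!: sum_nonneg divide_nonneg_nonneg)
  have H: "0 \<le> shift_error t" unfolding shift_error_def by (auto intro!: sum_nonneg)
  let ?V = "\<Sum>i=1..n. sampling_variance t i"
  have V: "?V \<le> 4 * G + 2 * W"
    using sum_sampling_variance_le[of t] by (simp add: G_def W_def mult_ac)
  have P: "grad_error t \<le> 2 * G" using grad_error_le[of t] by (simp add: G_def mult_ac)
  have B: "shift_gap t \<le> 4 * G + 2 * shift_error t" using shift_gap_le[of t] P by simp
  have noise: "((\<omega> + 1) * ?V + \<omega> * shift_gap t) / (real n)\<^sup>2 \<le> \<rho> * (8 * G + 2 * W + 2 * shift_error t)"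
  proof -
    have "(\<omega> + 1) * ?V + \<omega> * shift_gap t \<le> (\<omega> + 1) * ?V + (\<omega> + 1) * shift_gap t"
      using shift_gap_nonneg[of t] by (simp add: algebra_simps)
    also have "\<dots> \<le> (\<omega> + 1) * (4 * G + 2 * W) + (\<omega> + 1) * (4 * G + 2 * shift_error t)"
      using \<omega> by (intro add_mono mult_left_mono V B) auto
    also have "\<dots> = (\<omega> + 1) * (8 * G + 2 * W + 2 * shift_error t)" by (simp add: algebra_simps)
    finally show ?thesis unfolding \<rho>_def by (simp add: divide_right_mono)
  qed
  have X: "distance (Suc t) \<le> distance t - 2 * \<gamma> * expected_gap t
      + \<gamma>\<^sup>2 * (2 * L * expected_gap t + \<rho> * (8 * G + 2 * W + 2 * shift_error t))"
    using distance_Suc_le[of t]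
      mult_left_mono[OF add_left_mono[OF noise, of "2 * L * expected_gap t"], of "\<gamma>\<^sup>2"] by simp
  have "shift_error (Suc t) \<le> shift_error t + \<alpha> * (6 * G + 2 * W - shift_error t)"
    using shift_error_Suc_le[of t] mult_left_mono[OF add_mono[OF P V], of \<alpha>] \<alpha>(1)
    by (simp add: algebra_simps)
  then have "4 * \<rho> / \<alpha> * \<gamma>\<^sup>2 * shift_error (Suc t)
      \<le> 4 * \<rho> / \<alpha> * \<gamma>\<^sup>2 * (shift_error t + \<alpha> * (6 * G + 2 * W - shift_error t))"
    using \<rho> \<alpha>(1) by (intro mult_left_mono) auto
  also have "\<dots> = 4 * \<rho> / \<alpha> * \<gamma>\<^sup>2 * shift_error t + \<gamma>\<^sup>2 * (\<rho> * (24 * G + 8 * W - 4 * shift_error t))"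
    using \<alpha>(1) by (simp add: field_simps)
  finally have S: "4 * \<rho> / \<alpha> * \<gamma>\<^sup>2 * shift_error (Suc t) \<le> 4 * \<rho> / \<alpha> * \<gamma>\<^sup>2 * shift_error t
      + \<gamma>\<^sup>2 * (\<rho> * (24 * G + 8 * W - 4 * shift_error t))" .
  have "ref_error (Suc t) \<le> ref_error t + (2 * G - W)"
    using ref_error_Suc_le[of t] by (simp add: G_def W_def algebra_simps)
  then have "16 * \<rho> * \<gamma>\<^sup>2 * ref_error (Suc t) \<le> 16 * \<rho> * \<gamma>\<^sup>2 * (ref_error t + (2 * G - W))"
    using \<rho> by (intro mult_left_mono) auto
  also have "\<dots> = 16 * \<rho> * \<gamma>\<^sup>2 * ref_error t + \<gamma>\<^sup>2 * (\<rho> * (32 * G - 16 * W))"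
    by (simp add: algebra_simps)
  finally have R: "16 * \<rho> * \<gamma>\<^sup>2 * ref_error (Suc t) \<le> 16 * \<rho> * \<gamma>\<^sup>2 * ref_error t
      + \<gamma>\<^sup>2 * (\<rho> * (32 * G - 16 * W))" .
  have coeffs: "potential r = distance r + 4 * \<rho> / \<alpha> * \<gamma>\<^sup>2 * shift_error r + 16 * \<rho> * \<gamma>\<^sup>2 * ref_error r" for r
    by (simp add: potential_def \<rho>_def)
  have "potential (Suc t) \<le> potential t - 2 * \<gamma> * expected_gap t + \<gamma>\<^sup>2 * (2 * L * expected_gap t
      + \<rho> * (8 * G + 2 * W + 2 * shift_error t) + \<rho> * (24 * G + 8 * W - 4 * shift_error t)
      + \<rho> * (32 * G - 16 * W))"
    using X S R unfolding coeffs by (simp add: algebra_simps)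
  also have "\<dots> \<le> potential t - 2 * \<gamma> * expected_gap t + \<gamma>\<^sup>2 * (2 * L * expected_gap t + \<rho> * (72 * G))"
  proof -
    have "\<rho> * (8 * G + 2 * W + 2 * shift_error t) + \<rho> * (24 * G + 8 * W - 4 * shift_error t)
        + \<rho> * (32 * G - 16 * W) = \<rho> * (64 * G - 6 * W - 2 * shift_error t)"
      by (simp add: algebra_simps)
    also have "\<dots> \<le> \<rho> * (72 * G)" using \<rho> G W H by (intro mult_left_mono) auto
    finally show ?thesis by (intro add_left_mono mult_left_mono) auto
  qed
  finally have "potential (Suc t) \<le> potential t - 2 * \<gamma> * expected_gap t
      + \<gamma>\<^sup>2 * (2 * L * expected_gap t + \<rho> * (72 * G))" .
  moreover have "\<rho> * (72 * G) = 72 * L * (\<omega> + 1) / real n * expected_gap t"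
    using n by (simp add: \<rho>_def G_def power2_eq_square)
  ultimately have "potential (Suc t) \<le> potential t - 2 * \<gamma> * expected_gap t
      + \<gamma>\<^sup>2 * (2 * L * expected_gap t + 72 * L * (\<omega> + 1) / real n * expected_gap t)" by simp
  also have "\<dots> = potential t
      - 2 * (\<gamma> - L * \<gamma>\<^sup>2 * (1 + 36 * (\<omega> + 1) / real n)) * expected_gap t"
    using n by (simp add: field_simps)
  finally show ?thesis .
qed

lemma sum_expected_gap_le:
  "2 * (\<gamma> - L * \<gamma>\<^sup>2 * (1 + 36 * (\<omega> + 1) / real n)) * (\<Sum>t<r. expected_gap t) \<le> potential 0"
proof -
  let ?\<kappa> = "2 * (\<gamma> - L * \<gamma>\<^sup>2 * (1 + 36 * (\<omega> + 1) / real n))"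
  have "potential r + ?\<kappa> * (\<Sum>t<r. expected_gap t) \<le> potential 0"
  proof (induction r)
    case (Suc r)
    have "potential (Suc r) + ?\<kappa> * (\<Sum>t<Suc r. expected_gap t)
        = (potential (Suc r) + ?\<kappa> * expected_gap r) + ?\<kappa> * (\<Sum>t<r. expected_gap t)"
      by (simp only: sum.lessThan_Suc distrib_left add_ac)
    also have "\<dots> \<le> potential r + ?\<kappa> * (\<Sum>t<r. expected_gap t)"
      using potential_Suc_le[of r] by (intro add_right_mono) linarith
    finally show ?case using Suc by linarith
  qed simp
  then show ?thesis using potential_nonneg[of r] by linarith
qed

lemma expected_output_gap:
  shows "integrable M (\<lambda>p. gap (x (a p) p))"
    and "(\<integral>p. gap (x (a p) p) \<partial>M) = (1 / real k) * (\<Sum>t<k. expected_gap t)"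
proof -
  have gm: "(\<lambda>p. gap (x t p)) \<in> borel_measurable (known (past k))" if "t \<in> {0..<k}" for t
    using that by (intro measurable_known_mono[OF gap_measurable_known past_mono past_subset]) auto
  have pr: "\<And>t. t \<in> {0..<k} \<Longrightarrow> prob {p \<in> space M. a p = t} = 1 / real k"
    by (simp add: prob_output)
  note sel = expectation_select_drawn[OF drawn_output _ pr gm integrable_gap past_subset not_in_past(4),
      simplified]
  show "integrable M (\<lambda>p. gap (x (a p) p))" by (rule sel(1))
  show "(\<integral>p. gap (x (a p) p) \<partial>M) = (1 / real k) * (\<Sum>t<k. expected_gap t)"
    using sel(2) by (simp add: expected_gap_def lessThan_atLeast0)
qed

end

theorem theorem3:
  fixes f :: "nat \<Rightarrow> nat \<Rightarrow> 'a::euclidean_space \<Rightarrow> real"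
    and Q :: "'s \<Rightarrow> 'a \<Rightarrow> 'a" and S :: "'s measure" and M :: "'o measure"
    and u :: "nat \<Rightarrow> 'o \<Rightarrow> bool" and j :: "nat \<Rightarrow> nat \<Rightarrow> 'o \<Rightarrow> nat"
    and s :: "nat \<Rightarrow> nat \<Rightarrow> 'o \<Rightarrow> 's" and a :: "'o \<Rightarrow> nat"
    and x0 xs :: 'a and h0 :: "nat \<Rightarrow> 'a" and w0 :: "nat \<Rightarrow> nat \<Rightarrow> 'a"
    and L \<alpha> \<gamma> \<omega> :: real and n m k :: nat and v :: variant
  assumes "n \<ge> 1" and "m \<ge> 1" and "L > 0"
    and "\<And>i j. i \<in> {1..n} \<Longrightarrow> j \<in> {1..m} \<Longrightarrow> convex_on UNIV (f i j)"
    and "\<And>i j. i \<in> {1..n} \<Longrightarrow> j \<in> {1..m} \<Longrightarrow> L_smooth L (f i j)"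
    and "\<And>y. global_obj n m f xs \<le> global_obj n m f y"
    and "\<omega> \<ge> 0" and "quantization_operator \<omega> S Q"
    and "0 < \<alpha>" and "\<alpha> \<le> 1 / (\<omega> + 1)"
    and "0 < \<gamma>" and "\<gamma> < 1 / (L * (1 + 36 * (\<omega> + 1) / real n))"
    and "k \<ge> 1"
    and "vr_diana_randomness v n m k S M u j s a"
  defines "X \<equiv> \<lambda>t p. iter (vr_diana v n m f \<alpha> \<gamma> Q x0 h0 w0
             (\<lambda>t. u t p) (\<lambda>t i. j t i p) (\<lambda>t i. s t i p) t)"
    and "b \<equiv> 4 * (\<omega> + 1) / (\<alpha> * (real n)\<^sup>2)"
    and "c \<equiv> 16 * (\<omega> + 1) / (real n)\<^sup>2"
  shows "integrable M (\<lambda>p. global_obj n m f (X (a p) p) - global_obj n m f xs) \<and>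
    (\<integral>p. (global_obj n m f (X (a p) p) - global_obj n m f xs) \<partial>M)
      \<le> initial_potential n m f \<gamma> b c xs x0 h0 w0
         / (2 * real k * (\<gamma> - L * \<gamma>\<^sup>2 * (1 + 36 * (\<omega> + 1) / real n)))"
proof -
  interpret vr_diana_run n m f L xs \<omega> \<alpha> \<gamma> v k S Q M u j s a x0 h0 w0
    by unfold_locales (use assms in auto)
  let ?\<beta> = "1 + 36 * (\<omega> + 1) / real n"
  let ?\<kappa> = "\<gamma> - L * \<gamma>\<^sup>2 * ?\<beta>"
  have X: "X = x" by (simp add: X_def x_def[abs_def] state_def)
  have "L * ?\<beta> > 0" using \<open>L > 0\<close> \<open>\<omega> \<ge> 0\<close> by (intro mult_pos_pos add_pos_nonneg) auto
  then have "\<gamma> * (L * ?\<beta>) < 1" using assms(12) by (simp add: less_divide_eq)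
  then have "0 < \<gamma> * (1 - \<gamma> * (L * ?\<beta>))" using \<open>0 < \<gamma>\<close> by simp
  also have "\<dots> = ?\<kappa>" by (simp add: algebra_simps power2_eq_square)
  finally have \<kappa>: "0 < ?\<kappa>" .
  have pot: "potential 0 = initial_potential n m f \<gamma> b c xs x0 h0 w0"
    by (simp add: potential_0 b_def c_def)
  have "(\<Sum>t<k. expected_gap t) * (2 * ?\<kappa>) \<le> potential 0"
    using sum_expected_gap_le[of k] by (simp only: mult_ac)
  then have "(\<Sum>t<k. expected_gap t) \<le> potential 0 / (2 * ?\<kappa>)"
    using \<kappa> by (subst pos_le_divide_eq) auto
  then have "(1 / real k) * (\<Sum>t<k. expected_gap t) \<le> (1 / real k) * (potential 0 / (2 * ?\<kappa>))"
    by (intro mult_left_mono) auto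
  also have "\<dots> = potential 0 / (2 * real k * ?\<kappa>)" by simp
  finally have "(\<integral>p. gap (x (a p) p) \<partial>M) \<le> potential 0 / (2 * real k * ?\<kappa>)"
    unfolding expected_output_gap(2) .
  with expected_output_gap(1) show ?thesis
    unfolding X pot gap_def by blast
qed

end
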